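(* Let $a\geq 5$ and let $D$ be a strongly connected balanced bipartite digraph of order $2a$ which is not (isomorphic to) the directed cycle of length $2a$. Suppose that $\max\{d(x),d(y)\}\geq 2a-2$ for every dominating pair of vertices $\{x,y\}$ of $D$. Then $D$ contains cycles of all lengths $2,4,\ldots,2a-2$, unless $D$ is isomorphic to the digraph $D(10)$ (of order $10$) defined in the context.
   Context: Digraphs are finite, without loops and without multiple arcs (but both arcs $xy$ and $yx$ may be present). For vertices $x,y$, write $x\rightarrow y$ if $xy$ is an arc, and $x\leftrightarrow y$ if both $x\rightarrow y$ and $y\rightarrow x$; for disjoint vertex sets $A,B$, $A\rightarrow B$ means every vertex of $A$ dominates every vertex of $B$ (i.e. $x\rightarrow y$ for all $x\in A$, $y\in B$). The order of a digraph is its number of vertices. The degree of $x$ is $d(x)=d^+(x)+d^-(x)$, the sum of its out-degree and in-degree. Cycles are directed cycles with distinct vertices; a cycle of length $2$ is a pair $x\leftrightarrow y$. A digraph is bipartite if its vertex set can be partitioned into two partite sets $X,Y$ such that every arc has its end-vertices in different partite sets; it is balanced if $|X|=|Y|$. A digraph is strongly connected if for every ordered pair of distinct vertices $(x,y)$ there is a directed path from $x$ to $y$. A pair $\{x,y\}$ of distinct vertices is called dominating if there is a vertex $z$ with $x\rightarrow z$ and $y\rightarrow z$. The digraph $D(10)$: it is the bipartite digraph with partite sets $X=\{x_0,x_1,x_2,x_3,x_4\}$ and $Y=\{y_0,y_1,y_2,y_3,y_4\}$ whose arcs are exactly the following: $x_i\leftrightarrow y_j$ for all $i\in\{1,2,3\}$,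 $j\in\{0,1\}$; $\{x_1,x_2,x_3\}\rightarrow\{y_2,y_3,y_4\}$; $x_4\leftrightarrow y_1$; $x_0\leftrightarrow y_0$; and $x_i\leftrightarrow y_{i+1}$ for $i\in\{1,2,3\}$. It has no other arcs. *)

theory Defs
  imports "Graph_Theory.Graph_Theory"
begin

definition balanced_bipartite :: "('a, 'b) pre_digraph \<Rightarrow> bool" where
  "balanced_bipartite G \<longleftrightarrow>
    (\<exists>X Y. X \<union> Y = verts G \<and> X \<inter> Y = {} \<and> card X = card Y \<and>
      (\<forall>e \<in> arcs G. (tail G e \<in> X \<and> head G e \<in> Y) \<or> (tail G e \<in> Y \<and> head G e \<in> X)))"

definition degree :: "('a, 'b) pre_digraph \<Rightarrow> 'a \<Rightarrow> nat" where
  "degree G v = out_degree G v + in_degree G v"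

definition dominating_pair :: "('a, 'b) pre_digraph \<Rightarrow> 'a \<Rightarrow> 'a \<Rightarrow> bool" where
  "dominating_pair G x y \<longleftrightarrow>
    x \<in> verts G \<and> y \<in> verts G \<and> x \<noteq> y \<and> (\<exists>z \<in> verts G. x \<rightarrow>\<^bsub>G\<^esub> z \<and> y \<rightarrow>\<^bsub>G\<^esub> z)"

text \<open>The library cycles are closed arc walks, so \<open>length\<close> counts arcs; a 2-cycle
  \<open>x, y, x\<close> is admitted.\<close>
definition has_cycle_of_length :: "('a, 'b) pre_digraph \<Rightarrow> nat \<Rightarrow> bool" where
  "has_cycle_of_length G n \<longleftrightarrow> (\<exists>p. pre_digraph.cycle G p \<and> length p = n)"

definition directed_cycle :: "nat \<Rightarrow> (nat, nat \<times> nat) pre_digraph" where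
  "directed_cycle n =
    with_proj \<lparr> pverts = {0..<n}, parcs = {(i, Suc i mod n) | i. i < n} \<rparr>"

text \<open>In \<open>D(10)\<close>, \<open>Inl i\<close> is the vertex $x_i$ and \<open>Inr j\<close> is the vertex $y_j$.\<close>

definition D10_two_way :: "(nat + nat) rel" where
  "D10_two_way =
    {(Inl i, Inr j) | i j. i \<in> {1, 2, 3} \<and> j \<in> {0, 1}} \<union>
    {(Inl 4, Inr 1), (Inl 0, Inr 0)} \<union>
    {(Inl i, Inr (i + 1)) | i. i \<in> {1, 2, 3}}"

definition D10_one_way :: "(nat + nat) rel" where
  "D10_one_way = {(Inl i, Inr j) | i j. i \<in> {1, 2, 3} \<and> j \<in> {2, 3, 4}}"

text \<open>For \<open>i \<in> {1, 2, 3}\<close> the arc $x_i \to y_{i+1}$ lies in both relations: the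
  two-way condition contributes the reverse arc to it.\<close>
definition D10 :: "(nat + nat, (nat + nat) \<times> (nat + nat)) pre_digraph" where
  "D10 = with_proj
    \<lparr> pverts = Inl ` {0..4} \<union> Inr ` {0..4},
      parcs = D10_two_way \<union> D10_two_way\<inverse> \<union> D10_one_way \<rparr>"

end

theory Submission
  imports Defs
begin

text \<open>Call a vertex low if its degree is below \<open>2 * a - 2\<close> and high otherwise. Low vertices of one
  partite set have disjoint out-neighbourhoods, while a high vertex misses at most two of its
  \<open>2 * a\<close> possible arcs. If one side has no high vertex, then all in-degrees are 1 and the digraph is a
  directed cycle. Otherwise a high vertex of one side allows at most three low vertices on the other
  side, so the digraph is nearly complete.

  An adjacent pair of high vertices outside a cycle of length at least 6 can be inserted into the
  cycle, because the few missing arcs cannot block all positions. Hence a cycle that misses at most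
  one low vertex on each side grows to length \<open>2 * a - 2\<close>. On the way it reaches length
  \<open>2 * a - 4\<close> while avoiding a high vertex \<open>v\<close>, and shortcuts through \<open>v\<close> yield all shorter even
  lengths. It remains to find a starting cycle; this is a case distinction on the numbers of low
  vertices, in which \<open>D(10)\<close> is the only obstruction.\<close>

section \<open>Cycles as vertex lists\<close>

text \<open>Two low vertices with a common out-neighbour would be a dominating pair that violates
  the degree condition; hence the disjointness. It also gives the constant three: a high vertex
  misses at most two in-arcs, and at most one low vertex of the other side dominates it. So three
  low vertices exhaust the misses of every high vertex opposite, and two of them cost it at least
  one miss. This is why the cases are split by these numbers.

  Growth needs a high pair off the cycle at every length up to \<open>2 * a - 4\<close>. Such a
  cycle omits two vertices of each side, so one omitted low vertex per side can be tolerated. Length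
  six is the threshold because four missing arcs cannot block a pair there, while a 4-cycle can
  resist.

  The tight cases have small \<open>a\<close>: a starting cycle may already have length
  \<open>2 * a - 2\<close>, and a shorter cycle avoiding a high vertex has to be given separately.
  In \<open>D(10)\<close> each of \<open>x0\<close> and \<open>x4\<close> lies on no cycle except
  one 2-cycle, so only three vertices of that side are left for longer cycles and length 8 is
  impossible.\<close>

definition cyc :: "('v \<Rightarrow> 'v \<Rightarrow> bool) \<Rightarrow> 'v list \<Rightarrow> bool" where
  "cyc E c \<longleftrightarrow> c \<noteq> [] \<and> distinct c \<and> successively E (c @ [hd c])"

lemma cyc_append_commute:
  assumes "cyc E (u @ v)"
  shows "cyc E (v @ u)"
  using assms unfolding cyc_def
  by (cases "u = []"; cases "v = []") (auto simp: successively_append_iff)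

lemma cyc_rotate: "cyc E c \<Longrightarrow> cyc E (rotate n c)"
  by (metis append_take_drop_id cyc_append_commute rotate_drop_take)

lemma cyc_rotate_to:
  assumes "cyc E c" "v \<in> set c"
  obtains c' where "cyc E (v # c')" "set (v # c') = set c" "length (v # c') = length c"
proof -
  obtain p q where "c = p @ v # q" using assms(2) by (meson split_list)
  then show thesis using assms(1) cyc_append_commute[of E p "v # q"] that[of "q @ p"] by auto
qed

lemma cyc_nth:
  assumes "cyc E c" "i < length c"
  shows "E (c ! i) (c ! (Suc i mod length c))"
proof -
  have "successively E (c @ [hd c])" using assms(1) by (simp add: cyc_def)
  then have "E ((c @ [hd c]) ! i) ((c @ [hd c]) ! Suc i)"
    using assms(2) by (simp add: successively_conv_nth)
  moreover have "hd c = c ! 0" using assms(1) by (simp add: cyc_def hd_conv_nth)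
  ultimately show ?thesis
    using assms(2) by (auto simp: nth_append split: if_splits)
      (metis Suc_lessI mod_less mod_self)+
qed

locale bipartite_arcs =
  fixes E :: "'v \<Rightarrow> 'v \<Rightarrow> bool" and X Y :: "'v set"
  assumes fin: "finite X" "finite Y"
    and disj: "X \<inter> Y = {}"
    and arcs: "E u v \<Longrightarrow> u \<in> X \<and> v \<in> Y \<or> u \<in> Y \<and> v \<in> X"
begin

lemma arcD1: "E u v \<Longrightarrow> u \<in> X \<Longrightarrow> v \<in> Y" and arcD2: "E u v \<Longrightarrow> u \<in> Y \<Longrightarrow> v \<in> X"
  and arcD3: "E u v \<Longrightarrow> v \<in> X \<Longrightarrow> u \<in> Y" and arcD4: "E u v \<Longrightarrow> v \<in> Y \<Longrightarrow> u \<in> X"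
  using arcs disj by blast+

text \<open>A vertex of the list counts +1 or -1 according to its side. As sides alternate, this is
  the change of the indicator of \<open>X\<close> along the arc that leaves it, and the sum
  telescopes. For a closed list it vanishes, which balances cycles.\<close>

lemma filter_balance:
  assumes "successively E (c @ [t])" "t \<in> X \<union> Y"
  shows "int (length (filter (\<lambda>v. v \<in> X) c)) - int (length (filter (\<lambda>v. v \<in> Y) c)) =
    of_bool (hd (c @ [t]) \<in> X) - of_bool (t \<in> X)"
  using assms(1)
proof (induction c)
  case (Cons v c)
  then have "E v (hd (c @ [t]))" "successively E (c @ [t])"
    by (auto simp: successively_Cons)
  then show ?case using Cons.IH arcs[of v "hd (c @ [t])"] disj by auto
qed simp

lemma cyc_props:
  assumes "cyc E c"
  shows "set c \<subseteq> X \<union> Y" "card (set c \<inter> X) = card (set c \<inter> Y)"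
    "length c = 2 * card (set c \<inter> X)"
proof -
  have sub: "v \<in> X \<union> Y" if "v \<in> set c" for v
    using that cyc_nth[OF assms] arcs by (metis Un_iff in_set_conv_nth)
  then show "set c \<subseteq> X \<union> Y" by auto
  have d: "distinct c" and ne: "c \<noteq> []" using assms by (auto simp: cyc_def)
  have f: "length (filter (\<lambda>v. v \<in> S) c) = card (set c \<inter> S)" for S
    using distinct_card[of "filter (\<lambda>v. v \<in> S) c"] d by (simp add: Int_def)
  have "int (card (set c \<inter> X)) - int (card (set c \<inter> Y)) =
      of_bool (hd (c @ [hd c]) \<in> X) - of_bool (hd c \<in> X)"
    using filter_balance[of c "hd c"] assms sub ne by (simp add: cyc_def f)
  then show eq: "card (set c \<inter> X) = card (set c \<inter> Y)" using ne by simp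
  have "length c = card (set c)" using d by (simp add: distinct_card)
  also have "set c = set c \<inter> X \<union> set c \<inter> Y" using sub by auto
  also have "card \<dots> = card (set c \<inter> X) + card (set c \<inter> Y)"
    using disj by (intro card_Un_disjoint) auto
  finally show "length c = 2 * card (set c \<inter> X)" using eq by simp
qed

lemma cyc_nth_parity:
  assumes "cyc E c" "i < length c" "c ! i \<in> Y"
  shows "c ! ((i + 2 * n) mod length c) \<in> Y"
proof (induction n)
  case (Suc n)
  define j where "j = (i + 2 * n) mod length c"
  have l: "0 < length c" using assms(2) by auto
  have "j < length c" using l by (simp add: j_def)
  then have "E (c ! j) (c ! (Suc j mod length c))" using cyc_nth[OF assms(1)] by auto
  moreover have "E (c ! (Suc j mod length c)) (c ! (Suc (Suc j mod length c) mod length c))"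
    using cyc_nth[OF assms(1)] l by auto
  ultimately have "c ! (Suc (Suc j mod length c) mod length c) \<in> Y"
    using Suc j_def arcD1 arcD2 by blast
  moreover have "Suc (Suc j mod length c) mod length c = (i + 2 * Suc n) mod length c"
    unfolding j_def by (simp add: mod_simps)
  ultimately show ?case by simp
qed (use assms in simp)

text \<open>The out-neighbours of \<open>v\<close> on the cycle, shifted by \<open>2 * m - 2\<close> positions, must meet its
  in-neighbours.\<close>

lemma cyc_through_outside_vertex:
  assumes c: "cyc E c" and len: "length c = 2 * b" and v: "v \<in> X" "v \<notin> set c"
    and deg: "card {u \<in> set c. E v u} + card {u \<in> set c. E u v} > b"
    and m: "1 \<le> m" "m \<le> b"
  shows "\<exists>c'. cyc E c' \<and> length c' = 2 * m"
proof -
  have d: "distinct c" and ne: "c \<noteq> []" using c by (auto simp: cyc_def)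
  define n where "n = length c"
  have n: "n > 0" using ne by (simp add: n_def)
  \<comment> \<open>A segment of \<open>s\<close> arcs has \<open>2 * m - 1\<close> vertices, and
    \<open>v\<close> completes it to length \<open>2 * m\<close>. For \<open>m = 1\<close> the
    segment is a single vertex joined to \<open>v\<close> in both directions.\<close>
  define s where "s = 2 * (m - 1)"
  have s: "s < n" using m len by (auto simp: s_def n_def)
  define T where "T = {i. i < n \<and> c ! i \<in> Y}"
  have card_nth: "card {i. i < n \<and> c ! i \<in> S} = card {u \<in> set c. u \<in> S}" for S
  proof -
    have "bij_betw (\<lambda>i. c ! i) {i. i < n \<and> c ! i \<in> S} {u \<in> set c. u \<in> S}"
      unfolding bij_betw_def using d
      by (auto simp: inj_on_def nth_eq_iff_index_eq n_def in_set_conv_nth image_iff)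
    then show ?thesis by (rule bij_betw_same_card)
  qed
  have "card T = b"
    using card_nth[of Y] cyc_props[OF c] len by (simp add: T_def Int_def)
  define Ou where "Ou = {i. i < n \<and> c ! i \<in> {u. E v u}}"
  define In where "In = {i. i < n \<and> c ! i \<in> {u. E u v}}"
  have cd: "card Ou + card In > b"
    using deg card_nth[of "{u. E v u}"] card_nth[of "{u. E u v}"] by (simp add: Ou_def In_def)
  have "Ou \<subseteq> T" "In \<subseteq> T" using arcD1 arcD3 v by (auto simp: Ou_def In_def T_def)
  define f where "f i = (i + s) mod n" for i
  have inj: "inj_on f {..<n}"
  proof (rule inj_onI)
    fix i j assume ij: "i \<in> {..<n}" "j \<in> {..<n}" "f i = f j"
    have "f k = (if k + s < n then k + s else k + s - n)" if "k < n" for k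
      using that s by (auto simp: f_def mod_if)
    then show "i = j" using ij s by (auto split: if_splits)
  qed
  have "f ` Ou \<subseteq> T"
    using cyc_nth_parity[OF c, of _ "m - 1"] n \<open>Ou \<subseteq> T\<close> unfolding T_def f_def s_def n_def by auto
  moreover have "card (f ` Ou) = card Ou"
    using inj by (intro card_image) (auto simp: Ou_def inj_on_def)
  moreover have "finite T" by (simp add: T_def)
  \<comment> \<open>Both sets lie among the \<open>b\<close> positions occupied by \<open>Y\<close>,
    and their sizes add up to more than \<open>b\<close>.\<close>
  ultimately have "f ` Ou \<inter> In \<noteq> {}"
    using cd \<open>card T = b\<close> \<open>In \<subseteq> T\<close> card_Un_disjoint[of "f ` Ou" In] card_mono[of T "f ` Ou \<union> In"]
    by (metis Un_least finite_subset not_le)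
  then obtain i where i: "i < n" "E v (c ! i)" "E (c ! ((i + s) mod n)) v"
    by (auto simp: Ou_def In_def f_def)
  define c' where "c' = rotate i c"
  have lc': "length c' = n" by (simp add: c'_def n_def)
  have c': "cyc E c'" unfolding c'_def by (rule cyc_rotate[OF c])
  have nth0: "c' ! 0 = c ! i" and nths: "c' ! s = c ! ((i + s) mod n)"
    using n s i by (simp_all add: c'_def nth_rotate n_def)
  define p where "p = take (Suc s) c'"
  have "c' \<noteq> []" using lc' n by auto
  then have p: "p \<noteq> []" "length p = Suc s" "hd p = c ! i" "last p = c ! ((i + s) mod n)"
    using s lc' nth0 nths by (auto simp: p_def take_Suc_conv_app_nth hd_append hd_conv_nth)
  have "successively E c'" using c' by (auto simp: cyc_def successively_append_iff)
  then have "successively E p"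
    by (metis append_take_drop_id p_def successively_append_iff)
  moreover have "distinct p" using c' by (simp add: p_def cyc_def)
  moreover have "v \<notin> set p" using v by (auto simp: p_def c'_def dest!: in_set_takeD)
  ultimately have "cyc E (v # p)"
    using i p by (simp add: cyc_def successively_append_iff successively_Cons)
  moreover have "length (v # p) = 2 * m" using p m by (simp add: s_def)
  ultimately show ?thesis by blast
qed

end

section \<open>Growing a cycle\<close>

text \<open>\<open>LX\<close> and \<open>LY\<close> are the low vertices. The assumptions \<open>few_X\<close> and \<open>few_Y\<close> are the only
  consequences of their small degree that are needed besides the disjointness of out-neighbourhoods.\<close>

locale dominating_bipartite = bipartite_arcs E X Y
  for E :: "'v \<Rightarrow> 'v \<Rightarrow> bool" and X Y :: "'v set" +
  fixes LX LY :: "'v set" and a :: nat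
  assumes a: "5 \<le> a"
    and card_X: "card X = a" and card_Y: "card Y = a"
    and low_sub: "LX \<subseteq> X" "LY \<subseteq> Y"
    and low_card: "card LX \<le> 3" "card LY \<le> 3"
    and strong: "S \<subseteq> X \<union> Y \<Longrightarrow> S \<noteq> {} \<Longrightarrow> (\<And>u v. u \<in> S \<Longrightarrow> E u v \<Longrightarrow> v \<in> S) \<Longrightarrow> S = X \<union> Y"
    and low_X: "u \<in> LX \<Longrightarrow> v \<in> LX \<Longrightarrow> E u w \<Longrightarrow> E v w \<Longrightarrow> u = v"
    and low_Y: "u \<in> LY \<Longrightarrow> v \<in> LY \<Longrightarrow> E u w \<Longrightarrow> E v w \<Longrightarrow> u = v"
    and high_X: "x \<in> X - LX \<Longrightarrow> card {y \<in> Y. \<not> E x y} + card {y \<in> Y. \<not> E y x} \<le> 2"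
    and high_Y: "y \<in> Y - LY \<Longrightarrow> card {x \<in> X. \<not> E y x} + card {x \<in> X. \<not> E x y} \<le> 2"
    and few_X: "x \<in> LX \<Longrightarrow> y \<in> Y \<Longrightarrow> \<exists>y' \<in> Y - {y}. \<not> E x y' \<or> \<not> E y' x"
    and few_Y: "y \<in> LY \<Longrightarrow> x \<in> X \<Longrightarrow> \<exists>x' \<in> X - {x}. \<not> E y x' \<or> \<not> E x' y"
begin

text \<open>The assumptions of the locale come in mirrored pairs, so a lemma proved for one side is
  available for the other through this fact.\<close>

lemma swap: "dominating_bipartite E Y X LY LX a"
proof unfold_locales
  show "Y \<inter> X = {}" using disj by blast
  show "u \<in> Y \<and> v \<in> X \<or> u \<in> X \<and> v \<in> Y" if "E u v" for u v using arcs[OF that] by blast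
  show "S = Y \<union> X" if "S \<subseteq> Y \<union> X" "S \<noteq> {}" "\<And>u v. u \<in> S \<Longrightarrow> E u v \<Longrightarrow> v \<in> S" for S
    using strong[of S] that by (simp add: Un_commute)
qed (fact fin a card_X card_Y low_sub low_card low_X low_Y high_X high_Y few_X few_Y)+

text \<open>Three different misses at \<open>x\<close> are impossible. The four forms are the ways
  to distribute three misses over the two directions; in the mixed ones \<open>r\<close> may
  coincide with \<open>p\<close> or \<open>q\<close>, since opposite arcs are different misses. The
  disjunctive shape suits propositional reasoning.\<close>

lemma budget_X:
  assumes "x \<in> X - LX"
  shows "p \<in> Y \<Longrightarrow> q \<in> Y \<Longrightarrow> r \<in> Y \<Longrightarrow> p \<noteq> q \<Longrightarrow> p \<noteq> r \<Longrightarrow> q \<noteq> r \<Longrightarrow> E x p \<or> E x q \<or> E x r"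
    and "p \<in> Y \<Longrightarrow> q \<in> Y \<Longrightarrow> r \<in> Y \<Longrightarrow> p \<noteq> q \<Longrightarrow> E x p \<or> E x q \<or> E r x"
    and "p \<in> Y \<Longrightarrow> q \<in> Y \<Longrightarrow> r \<in> Y \<Longrightarrow> p \<noteq> q \<Longrightarrow> E x r \<or> E p x \<or> E q x"
    and "p \<in> Y \<Longrightarrow> q \<in> Y \<Longrightarrow> r \<in> Y \<Longrightarrow> p \<noteq> q \<Longrightarrow> p \<noteq> r \<Longrightarrow> q \<noteq> r \<Longrightarrow> E p x \<or> E q x \<or> E r x"
proof -
  define M where "M = {y \<in> Y. \<not> E x y} <+> {y \<in> Y. \<not> E y x}"
  have f: "finite M" using fin by (simp add: M_def)
  have "card M \<le> 2" using high_X[OF assms] fin by (simp add: M_def card_Plus)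
  then have *: "s = t \<or> s = w \<or> t = w" if "s \<in> M" "t \<in> M" "w \<in> M" for s t w
    using card_mono[of M "{s, t, w}"] f that by (auto simp: card_insert_if split: if_splits)
  have iff: "Inl y \<in> M \<longleftrightarrow> y \<in> Y \<and> \<not> E x y" "Inr y \<in> M \<longleftrightarrow> y \<in> Y \<and> \<not> E y x" for y
    by (auto simp: M_def)
  note ** = *[of "Inl p" "Inl q" "Inl r"] *[of "Inl p" "Inl q" "Inr r"]
    *[of "Inr p" "Inr q" "Inl r"] *[of "Inr p" "Inr q" "Inr r"]
  show "p \<in> Y \<Longrightarrow> q \<in> Y \<Longrightarrow> r \<in> Y \<Longrightarrow> p \<noteq> q \<Longrightarrow> p \<noteq> r \<Longrightarrow> q \<noteq> r \<Longrightarrow> E x p \<or> E x q \<or> E x r"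
    and "p \<in> Y \<Longrightarrow> q \<in> Y \<Longrightarrow> r \<in> Y \<Longrightarrow> p \<noteq> q \<Longrightarrow> E x p \<or> E x q \<or> E r x"
    and "p \<in> Y \<Longrightarrow> q \<in> Y \<Longrightarrow> r \<in> Y \<Longrightarrow> p \<noteq> q \<Longrightarrow> E x r \<or> E p x \<or> E q x"
    and "p \<in> Y \<Longrightarrow> q \<in> Y \<Longrightarrow> r \<in> Y \<Longrightarrow> p \<noteq> q \<Longrightarrow> p \<noteq> r \<Longrightarrow> q \<noteq> r \<Longrightarrow> E p x \<or> E q x \<or> E r x"
    using ** by (auto simp: iff)
qed

lemmas budget_Y = dominating_bipartite.budget_X[OF swap]

text \<open>On three consecutive pairs of the cycle, \<open>x\<close>, \<open>y\<close> can be
  inserted in front of \<open>v0\<close>, \<open>v1\<close> or \<open>v2\<close>; if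
  \<open>y\<close> also dominates \<open>x\<close>, then \<open>y\<close>, \<open>x\<close> can be
  inserted in front of \<open>u1\<close> or \<open>u2\<close>. Six vertices are what makes these
  places outnumber the possible misses.\<close>

lemma absorb_arc:
  assumes c: "cyc E c" "6 \<le> length c" and x: "x \<in> X - LX" "x \<notin> set c"
    and y: "y \<in> Y - LY" "y \<notin> set c" and xy: "E x y"
  shows "\<exists>c'. cyc E c' \<and> set c' = insert x (insert y (set c))"
proof (rule ccontr)
  assume no: "\<not> ?thesis"
  have "card (set c \<inter> Y) > 0" using cyc_props[OF c(1)] c(2) by auto
  then obtain u0 where "u0 \<in> set c" "u0 \<in> Y" by (auto simp: card_gt_0_iff)
  then obtain c1 where c1: "cyc E (u0 # c1)" "set (u0 # c1) = set c" "length (u0 # c1) = length c"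
    using cyc_rotate_to c(1) by metis
  obtain v0 u1 v1 u2 v2 r where c2: "c1 = v0 # u1 # v1 # u2 # v2 # r"
  proof -
    have "5 \<le> length c1" using c1(3) c(2) by simp
    then show thesis using that by (auto simp: Suc_le_length_iff numeral_eq_Suc)
  qed
  have arcs_c: "E u0 v0" "E v0 u1" "E u1 v1" "E v1 u2" "E u2 v2" "successively E (v2 # r @ [u0])"
    and dist: "distinct (u0 # v0 # u1 # v1 # u2 # v2 # r)"
    using c1(1) by (simp_all add: cyc_def c2)
  have mem: "v0 \<in> X" "u1 \<in> Y" "v1 \<in> X" "u2 \<in> Y" "v2 \<in> X"
    using arcs_c \<open>u0 \<in> Y\<close> arcD1 arcD2 by blast+
  have new: "x \<notin> set (u0 # c1)" "y \<notin> set (u0 # c1)" "x \<noteq> y"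
    using x y c1(2) disj by auto
  have block: "\<not> cyc E c'" if "set c' = insert x (insert y (set (u0 # c1)))" for c'
    using no that c1(2) by auto
  note facts = arcs_c dist new c2 xy
  have b1: "\<not> (E u0 x \<and> E y v0)"
    using block[of "u0 # x # y # v0 # u1 # v1 # u2 # v2 # r"] facts by (auto simp: cyc_def)
  have b2: "\<not> (E u1 x \<and> E y v1)"
    using block[of "u0 # v0 # u1 # x # y # v1 # u2 # v2 # r"] facts by (auto simp: cyc_def)
  have b3: "\<not> (E u2 x \<and> E y v2)"
    using block[of "u0 # v0 # u1 # v1 # u2 # x # y # v2 # r"] facts by (auto simp: cyc_def)
  have b4: "\<not> (E y x \<and> E v0 y \<and> E x u1)"
    using block[of "u0 # v0 # y # x # u1 # v1 # u2 # v2 # r"] facts by (auto simp: cyc_def)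
  have b5: "\<not> (E y x \<and> E v1 y \<and> E x u2)"
    using block[of "u0 # v0 # u1 # v1 # y # x # u2 # v2 # r"] facts by (auto simp: cyc_def)
  have dd: "u0 \<noteq> u1" "u0 \<noteq> u2" "u1 \<noteq> u2" "v0 \<noteq> v1" "v0 \<noteq> v2" "v1 \<noteq> v2"
    "y \<noteq> u0" "y \<noteq> u1" "y \<noteq> u2" "x \<noteq> v0" "x \<noteq> v1" "x \<noteq> v2"
    using dist new c2 by auto
  have "x \<in> X" "y \<in> Y" using x y by auto
  note mem = mem this \<open>u0 \<in> Y\<close>
  note bx = budget_X[OF x(1)] and cy = budget_Y[OF y(1)]
  \<comment> \<open>If \<open>y\<close> dominates \<open>x\<close>, the five blocked insertions
    require five different missing arcs. Otherwise three insertions are blocked by three arcs, and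
    the missing arc from \<open>y\<close> to \<open>x\<close> counts for both vertices, again five.
    Together \<open>x\<close> and \<open>y\<close> may have only four misses.\<close>
  show False
    using b1 b2 b3 b4 b5
     bx(4)[of u0 u1 u2] bx(3)[of u0 u1 u1] bx(3)[of u0 u1 u2] bx(3)[of u0 u2 u1] bx(3)[of u0 u2 u2]
     bx(3)[of u1 u2 u1] bx(3)[of u1 u2 u2] bx(2)[of u1 u2 u0] bx(2)[of u1 u2 u1] bx(2)[of u1 u2 u2]
     bx(4)[of u0 u1 y] bx(4)[of u0 u2 y] bx(4)[of u1 u2 y]
     cy(1)[of v0 v1 v2] cy(2)[of v0 v1 v0] cy(2)[of v0 v2 v0] cy(2)[of v1 v2 v0]
     cy(2)[of v0 v1 v1] cy(2)[of v0 v2 v1] cy(2)[of v1 v2 v1]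
     cy(3)[of v0 v1 v0] cy(3)[of v0 v1 v1] cy(3)[of v0 v1 v2]
     cy(1)[of v0 v1 x] cy(1)[of v0 v2 x] cy(1)[of v1 v2 x]
     dd mem
    by argo
qed


lemma absorb:
  assumes "cyc E c" "6 \<le> length c" "x \<in> X - LX" "x \<notin> set c" "y \<in> Y - LY" "y \<notin> set c"
    and "E x y \<or> E y x"
  shows "\<exists>c'. cyc E c' \<and> set c' = insert x (insert y (set c))"
  using assms absorb_arc[of c x y] dominating_bipartite.absorb_arc[OF swap, of c y x]
  by (auto simp: insert_commute)

lemma nonadjacent_high:
  assumes "x \<in> X - LX" "y \<in> Y" "\<not> E x y" "\<not> E y x" "y' \<in> Y" "y' \<noteq> y"
  shows "E x y'" "E y' x"
  using budget_X(2)[OF assms(1), of y y' y] budget_X(3)[OF assms(1), of y y' y] assms by auto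

lemma card_high: "2 \<le> card (X - LX)" "2 \<le> card (Y - LY)"
  using a card_X card_Y low_card low_sub fin
  by (auto simp: card_Diff_subset finite_subset)

text \<open>The condition depends on the vertex set only and passes to every larger one, so
  insertions preserve it.\<close>

definition good :: "'v list \<Rightarrow> bool" where
  "good c \<longleftrightarrow> cyc E c \<and> (\<forall>u \<in> LX - set c. \<forall>v \<in> LX - set c. u = v) \<and>
    (\<forall>u \<in> LY - set c. \<forall>v \<in> LY - set c. u = v)"

lemma swap_good: "dominating_bipartite.good E LY LX c \<longleftrightarrow> good c"
  unfolding good_def dominating_bipartite.good_def[OF swap] by blast

lemma high_outside_X:
  assumes "good c" "length c = 2 * b" "b \<le> a - 2"
  obtains x where "x \<in> X - LX" "x \<notin> set c"
proof -
  have c: "cyc E c" using assms by (simp add: good_def)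
  have "card (X - set c) = a - b"
    using cyc_props[OF c] assms(2) card_X fin by (simp add: card_Diff_subset_Int Int_commute)
  then have "\<not> card (X - set c) \<le> Suc 0" using assms(3) a by simp
  then obtain u v where "u \<in> X - set c" "v \<in> X - set c" "u \<noteq> v"
    using card_le_Suc0_iff_eq[of "X - set c"] fin by auto
  then show thesis using that assms(1) unfolding good_def by blast
qed

lemma replace_vertex:
  assumes c: "cyc E c" "2 \<le> length c" and z: "z \<in> set c" "z \<in> X" and x: "x \<notin> set c"
    and adj: "\<And>y. y \<in> set c \<Longrightarrow> y \<in> Y \<Longrightarrow> E x y \<and> E y x"
  shows "\<exists>c'. cyc E c' \<and> set c' = insert x (set c - {z})"
proof -
  obtain r where r: "cyc E (z # r)" "set (z # r) = set c" "length (z # r) = length c"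
    using cyc_rotate_to c(1) z(1) by metis
  have ne: "r \<noteq> []" using r(3) c(2) by auto
  have z_r: "E z (hd r)" "successively E r" "E (last r) z" and d: "z \<notin> set r" "distinct r"
    using r(1) ne by (simp_all add: cyc_def successively_append_iff successively_Cons)
  have sub: "set r = set c - {z}" using r(2) d(1) by auto
  have "E x (hd r)" "E (last r) x"
    using adj[of "hd r"] adj[of "last r"] hd_in_set[OF ne] last_in_set[OF ne] z_r z(2) arcD1 arcD3
    unfolding sub by blast+
  then have "cyc E (x # r)"
    using ne sub x d z_r(2) by (simp add: cyc_def successively_append_iff successively_Cons)
  moreover have "set (x # r) = insert x (set c - {z})" using sub by simp
  ultimately show ?thesis by blast
qed

lemma cyc_length: "cyc E c \<Longrightarrow> length c = card (set c)"
  by (simp add: cyc_def distinct_card)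

text \<open>Only a nonadjacent high pair \<open>x\<close>, \<open>y\<close> off the cycle is a
  problem. Then both have spent all their misses on each other, so \<open>y\<close> is adjacent to
  any other high \<open>z\<close>. If \<open>z\<close> is on the cycle, \<open>x\<close> can take
  its place there, which frees \<open>z\<close> to be inserted together with
  \<open>y\<close>.\<close>

lemma good_step:
  assumes c: "good c" "length c = 2 * b" "3 \<le> b" "b \<le> a - 2"
  shows "\<exists>c'. good c' \<and> length c' = 2 * Suc b"
proof -
  have cyc: "cyc E c" using c(1) by (simp add: good_def)
  obtain x where x: "x \<in> X - LX" "x \<notin> set c" using high_outside_X c by blast
  obtain y where y: "y \<in> Y - LY" "y \<notin> set c"
    using dominating_bipartite.high_outside_X[OF swap] c swap_good by metis
  have fin_step: ?thesis if "cyc E c'" "set c' = insert u (insert v (set c))" "u \<notin> set c" "v \<notin> set c" "u \<noteq> v"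
    for c' u v
  proof -
    have "length c' = 2 * Suc b"
      using that cyc_length[of c'] cyc_length[OF cyc] c(2) by simp
    moreover have "good c'" using c(1) that unfolding good_def by blast
    ultimately show ?thesis by blast
  qed
  have ne: "u \<noteq> v" if "u \<in> X - LX" "v \<in> Y - LY" for u v using that disj by auto
  have l: "6 \<le> length c" using c by simp
  show ?thesis
  proof (cases "E x y \<or> E y x")
    case True
    then show ?thesis using absorb[OF cyc l x y] fin_step x y ne by metis
  next
    case False
    have "\<exists>z \<in> X - LX. z \<noteq> x"
      using card_high(1) card_le_Suc0_iff_eq[of "X - LX"] fin x(1)
      by (metis finite_Diff not_less_eq_eq numeral_2_eq_2)
    then obtain z where z: "z \<in> X - LX" "z \<noteq> x" by blast
    have "E z y"
      using dominating_bipartite.nonadjacent_high[OF swap y(1), of x z] x z False by auto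
    show ?thesis
    proof (cases "z \<in> set c")
      case False
      then show ?thesis using absorb[OF cyc l z(1) _ y] \<open>E z y\<close> fin_step y ne z(1) by metis
    next
      case True
      have "E x u \<and> E u x" if "u \<in> set c" "u \<in> Y" for u
        using nonadjacent_high[OF x(1), of y u] False y that by auto
      then obtain d where d: "cyc E d" "set d = insert x (set c - {z})"
        using replace_vertex[OF cyc _ True _ x(2)] l z by auto
      have "length d = length c"
        using cyc_length[OF d(1)] cyc_length[OF cyc] card.remove[OF _ True] x(2) d(2) by simp
      moreover have "z \<notin> set d" "y \<notin> set d" using d z y x disj by auto
      ultimately obtain c' where "cyc E c'" "set c' = insert z (insert y (set d))"
        using absorb[OF d(1) _ z(1) _ y(1)] l \<open>E z y\<close> by auto
      moreover have "insert z (insert y (set d)) = insert x (insert y (set c))"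
        using d True by auto
      ultimately show ?thesis using fin_step[of c' x y] x y ne by auto
    qed
  qed
qed

lemma good_extend:
  assumes "good c" "length c = 2 * b" "3 \<le> b" "b \<le> b'" "b' \<le> a - 1"
  shows "\<exists>c'. good c' \<and> length c' = 2 * b'"
  using assms(4,5)
proof (induction b' rule: dec_induct)
  case (step n)
  then obtain c' where "good c'" "length c' = 2 * n" by auto
  then show ?case using good_step[of c' n] step assms(3) by auto
qed (use assms in blast)

definition even_pancyclic :: bool where
  "even_pancyclic \<longleftrightarrow> (\<forall>k \<in> {1..a - 1}. \<exists>c. cyc E c \<and> length c = 2 * k)"

lemma swap_even_pancyclic: "dominating_bipartite.even_pancyclic E a \<longleftrightarrow> even_pancyclic"
  unfolding even_pancyclic_def dominating_bipartite.even_pancyclic_def[OF swap] by blast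

text \<open>At most two arcs at \<open>v\<close> are missing, so at least \<open>2 * b - 2\<close>
  arcs join \<open>v\<close> to the cycle, and this exceeds \<open>b\<close> because
  \<open>b \<ge> 3\<close>.\<close>

lemma cycles_below:
  assumes c: "cyc E c" "length c = 2 * b" "3 \<le> b" and v: "v \<in> X - LX" "v \<notin> set c" and m: "1 \<le> m" "m \<le> b"
  shows "\<exists>c'. cyc E c' \<and> length c' = 2 * m"
proof (rule cyc_through_outside_vertex[OF c(1,2) _ v(2) _ m])
  have b: "card (set c \<inter> Y) = b" using cyc_props[OF c(1)] c(2) by simp
  have *: "card {u \<in> set c. P u} + card {u \<in> Y. \<not> P u} \<ge> b" if "\<And>u. P u \<Longrightarrow> u \<in> Y" for P
  proof -
    have "set c \<inter> Y \<subseteq> {u \<in> set c. P u} \<union> {u \<in> Y. \<not> P u}" by auto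
    then have "b \<le> card ({u \<in> set c. P u} \<union> {u \<in> Y. \<not> P u})"
      using b fin card_mono[of "{u \<in> set c. P u} \<union> {u \<in> Y. \<not> P u}" "set c \<inter> Y"] by simp
    also have "\<dots> \<le> card {u \<in> set c. P u} + card {u \<in> Y. \<not> P u}" by (rule card_Un_le)
    finally show ?thesis .
  qed
  have "v \<in> X" using v by simp
  then show "b < card {u \<in> set c. E v u} + card {u \<in> set c. E u v}"
    using *[of "E v"] *[of "\<lambda>u. E u v"] high_X[OF v(1)] arcD1 arcD3 c(3) by fastforce
qed (use v in auto)

text \<open>A cycle of length \<open>2 * (a - 1)\<close> may omit low vertices only, so it serves
  just for its own length. The other lengths come from \<open>c'\<close>, which still omits a high
  vertex of some side.\<close>

lemma even_pancyclicI:
  assumes "cyc E c" "length c = 2 * (a - 1)" "cyc E c'" "length c' = 2 * (a - 2)"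
    and v: "v \<in> (X - LX) \<union> (Y - LY)" "v \<notin> set c'"
  shows even_pancyclic
  unfolding even_pancyclic_def
proof
  fix k assume k: "k \<in> {1..a - 1}"
  have "3 \<le> a - 2" using a by simp
  then show "\<exists>c. cyc E c \<and> length c = 2 * k"
    using k assms cycles_below[of c' "a - 2" v k] dominating_bipartite.cycles_below[OF swap, of c' "a - 2" v k]
    by (cases "k = a - 1") auto
qed

lemma even_pancyclic_if_good:
  assumes "good c" "length c = 2 * b" "3 \<le> b" "b \<le> a - 2"
  shows even_pancyclic
proof -
  obtain c' where c': "good c'" "length c' = 2 * (a - 1)" using good_extend[of c b "a - 1"] assms by force
  obtain c'' where c'': "good c''" "length c'' = 2 * (a - 2)" using good_extend[of c b "a - 2"] assms by force
  obtain v where "v \<in> X - LX" "v \<notin> set c''" using high_outside_X[OF c''] by blast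
  then show ?thesis using even_pancyclicI[of c' c'' v] c' c'' by (simp add: good_def)
qed


section \<open>At most one low vertex on each side\<close>

text \<open>A high pair that cannot be inserted into a 4-cycle spends all its missing arcs on the cycle and
  on itself.\<close>

lemma blocked_four_cycle:
  assumes no: "\<nexists>c. cyc E c \<and> length c = 6"
    and c: "cyc E [z1, y1, z2, y2]" and mem: "z1 \<in> X" "z2 \<in> X" "y1 \<in> Y" "y2 \<in> Y"
    and z: "z \<in> X - LX" "z \<noteq> z1" "z \<noteq> z2" and y: "y \<in> Y - LY" "y \<noteq> y1" "y \<noteq> y2"
  shows "v \<in> Y \<Longrightarrow> v \<notin> {y1, y2, y} \<Longrightarrow> E z v \<and> E v z"
    and "\<exists>v \<in> {y1, y2, y}. \<not> E z v \<or> \<not> E v z"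
proof -
  have arcs_c: "E z1 y1" "E y1 z2" "E z2 y2" "E y2 z1" and d: "z1 \<noteq> z2" "y1 \<noteq> y2"
    using c by (auto simp: cyc_def)
  have xy: "u \<noteq> v" if "u \<in> X" "v \<in> Y" for u v using that disj by auto
  \<comment> \<open>One insertion for each arc of the 4-cycle: \<open>b1\<close> and
    \<open>b2\<close> insert \<open>z\<close>, \<open>y\<close> after a vertex of \<open>Y\<close>,
    \<open>b3\<close> and \<open>b4\<close> insert \<open>y\<close>, \<open>z\<close> after a vertex
    of \<open>X\<close>.\<close>
  have b1: "\<not> (E y1 z \<and> E z y \<and> E y z2)"
    using no[simplified, rule_format, of "[z1, y1, z, y, z2, y2]"] xy mem z y arcs_c d by (auto simp: cyc_def)
  have b2: "\<not> (E y2 z \<and> E z y \<and> E y z1)"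
    using no[simplified, rule_format, of "[z1, y1, z2, y2, z, y]"] xy mem z y arcs_c d by (auto simp: cyc_def)
  have b3: "\<not> (E z1 y \<and> E y z \<and> E z y1)"
    using no[simplified, rule_format, of "[z1, y, z, y1, z2, y2]"] xy mem z y arcs_c d by (auto simp: cyc_def)
  have b4: "\<not> (E z2 y \<and> E y z \<and> E z y2)"
    using no[simplified, rule_format, of "[z1, y1, z2, y, z, y2]"] xy mem z y arcs_c d by (auto simp: cyc_def)
  have yY: "y \<in> Y" "z \<in> X" using y z by auto
  have Y: "E y p \<or> E y q \<or> E r y" "E y r \<or> E p y \<or> E q y"
    if "p \<noteq> q" "p \<in> {z1, z2, z}" "q \<in> {z1, z2, z}" "r \<in> {z1, z2, z}" for p q r
    using budget_Y(2,3)[OF y(1), of p q r] that mem yY by auto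
  have Y1: "E y z1 \<or> E y z2 \<or> E y z" "E z1 y \<or> E z2 y \<or> E z y"
    using budget_Y(1,4)[OF y(1), of z1 z2 z] d z yY mem by auto
  have Y2: "E y z1 \<or> E y z2 \<or> E z1 y" "E y z1 \<or> E y z2 \<or> E z2 y" "E y z1 \<or> E y z2 \<or> E z y"
    "E y z1 \<or> E z1 y \<or> E z2 y" "E y z2 \<or> E z1 y \<or> E z2 y" "E y z \<or> E z1 y \<or> E z2 y"
    "E y z \<or> E y z1 \<or> E z y" "E y z \<or> E y z2 \<or> E z y" "E y z \<or> E z y \<or> E z1 y" "E y z \<or> E z y \<or> E z2 y"
    using Y[of z1 z2] Y[of z z1] Y[of z z2] d z(2,3) by auto
  \<comment> \<open>If \<open>z\<close> missed nothing here, all four insertions would have to be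
    blocked by misses of \<open>y\<close> at \<open>z1\<close> and \<open>z2\<close>.\<close>
  have "\<not> (E z y1 \<and> E y1 z \<and> E z y2 \<and> E y2 z \<and> E z y \<and> E y z)"
    using Y1 Y2 b1 b2 b3 b4 by argo
  then show "\<exists>v \<in> {y1, y2, y}. \<not> E z v \<or> \<not> E v z" by blast
  show "E z v \<and> E v z" if v: "v \<in> Y" "v \<notin> {y1, y2, y}"
  proof (rule ccontr)
    assume *: "\<not> (E z v \<and> E v z)"
    have "E z p \<or> E z q" "E p z \<or> E q z" if "p \<in> {y1, y2, y}" "q \<in> {y1, y2, y}" "p \<noteq> q" for p q
      using budget_X(1,2,3,4)[OF z(1), of p q v] * v that mem yY by blast+
    moreover have "E z p \<or> E q z" if "p \<in> {y1, y2, y}" "q \<in> {y1, y2, y}" for p q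
      using budget_X(2)[OF z(1), of p v q] budget_X(3)[OF z(1), of q v p] * v that mem yY by blast
    ultimately have Z: "E z y1 \<or> E z y2" "E y1 z \<or> E y2 z" "E z y1 \<or> E z y" "E z y2 \<or> E z y"
     "E y1 z \<or> E y z" "E y2 z \<or> E y z" "E z y1 \<or> E y1 z" "E z y1 \<or> E y2 z" "E z y2 \<or> E y1 z" "E z y2 \<or> E y2 z"
     "E z y1 \<or> E y z" "E z y2 \<or> E y z" "E z y \<or> E y1 z" "E z y \<or> E y2 z" "E z y \<or> E y z"
      using d y by auto
    \<comment> \<open>With one miss of \<open>z\<close> spent at \<open>v\<close>, three misses of
      \<open>z\<close> and \<open>y\<close> are left for four blocked insertions. A missing arc
      between \<open>z\<close> and \<open>y\<close> blocks two of them, but it is charged to both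
      vertices.\<close>
    show False using Z Y1 Y2 b1 b2 b3 b4 by argo
  qed
qed

end

lemma obtain_distinct_list:
  assumes "finite S" "n \<le> card S"
  obtains xs where "distinct xs" "length xs = n" "set xs \<subseteq> S"
proof -
  obtain T where "T \<subseteq> S" "card T = n" "finite T" using obtain_subset_with_card_n[OF assms(2)] by blast
  then show thesis using that finite_distinct_list[of T] distinct_card by metis
qed

lemma obtain_four:
  assumes "finite S" "4 \<le> card S"
  obtains p q r s where "distinct [p, q, r, s]" "{p, q, r, s} \<subseteq> S"
proof -
  obtain xs where "distinct xs" "length xs = 4" "set xs \<subseteq> S" using obtain_distinct_list[OF assms] .
  then show thesis using that by (auto simp: numeral_eq_Suc length_Suc_conv)
qed

context dominating_bipartite
begin

lemma bidirected:
  assumes "z \<in> X - LX" "p \<in> Y" "q \<in> Y" "r \<in> Y" "distinct [p, q, r]"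
  shows "\<exists>u \<in> {p, q, r}. E z u \<and> E u z"
  using budget_X(1)[of z p q r] budget_X(4)[of z p q r] budget_X(2,3)[of z p q r] budget_X(2,3)[of z p r q]
    budget_X(2,3)[of z q r p] assms by auto

text \<open>The two-way edges form the path \<open>y2\<close>, \<open>z1\<close>, \<open>y1\<close>,
  \<open>z2\<close>. It can be traversed in either direction, so an arc between its ends closes it
  whichever way it points.\<close>

lemma four_cycle_from_path:
  assumes "E z1 y1" "E y1 z1" "E z1 y2" "E y2 z1" "E z2 y1" "E y1 z2" "E z2 y2 \<or> E y2 z2"
    "z1 \<in> X" "z2 \<in> X" "y1 \<in> Y" "y2 \<in> Y" "z1 \<noteq> z2" "y1 \<noteq> y2"
  shows "cyc E [z1, y1, z2, y2] \<or> cyc E [z1, y2, z2, y1]"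
  using assms disj by (auto simp: cyc_def)

text \<open>Two misses leave \<open>p1\<close> with two-way edges to at least two of four high
  vertices, called \<open>y1\<close> and \<open>y2\<close>, and \<open>y1\<close> with another
  two-way partner \<open>z2\<close>. Only the edge between \<open>z2\<close> and \<open>y2\<close>
  can be absent.\<close>

lemma four_cycle:
  assumes "4 \<le> card (X - LX)" "4 \<le> card (Y - LY)"
  obtains z1 y1 z2 y2 where "cyc E [z1, y1, z2, y2]" "{z1, z2} \<subseteq> X - LX" "{y1, y2} \<subseteq> Y - LY"
proof -
  obtain p1 p2 p3 p4 where p: "distinct [p1, p2, p3, p4]" "{p1, p2, p3, p4} \<subseteq> X - LX"
    using obtain_four assms(1) fin by (metis finite_Diff)
  obtain q1 q2 q3 q4 where q: "distinct [q1, q2, q3, q4]" "{q1, q2, q3, q4} \<subseteq> Y - LY"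
    using obtain_four assms(2) fin by (metis finite_Diff)
  have bX: "\<exists>u \<in> {q, r, s}. E z u \<and> E u z"
    if "z \<in> X - LX" "{q, r, s} \<subseteq> Y - LY" "distinct [q, r, s]" for z q r s
    using bidirected[of z q r s] that by auto
  have bY: "\<exists>u \<in> {q, r, s}. E z u \<and> E u z"
    if "z \<in> Y - LY" "{q, r, s} \<subseteq> X - LX" "distinct [q, r, s]" for z q r s
    using dominating_bipartite.bidirected[OF swap, of z q r s] that by auto
  obtain y1 where y1: "y1 \<in> {q1, q2, q3}" "E p1 y1" "E y1 p1" using bX[of p1 q1 q2 q3] p q by auto
  have "\<exists>y2 \<in> {q1, q2, q3, q4} - {y1}. E p1 y2 \<and> E y2 p1"
    using bX[of p1 q2 q3 q4] bX[of p1 q1 q3 q4] bX[of p1 q1 q2 q4] p q y1(1) by auto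
  then obtain y2 where y2: "y2 \<in> {q1, q2, q3, q4}" "y2 \<noteq> y1" "E p1 y2" "E y2 p1" by auto
  have y: "y1 \<in> Y - LY" "y2 \<in> Y - LY" using y1 y2 q by auto
  obtain z2 where z2: "z2 \<in> {p2, p3, p4}" "E y1 z2" "E z2 y1" using bY[of y1 p2 p3 p4] p y by auto
  obtain z3 z4 where R: "{z3, z4} \<subseteq> {p2, p3, p4}" "z3 \<noteq> z4" "z3 \<noteq> z2" "z4 \<noteq> z2"
    using z2(1) p(1) by auto
  have mem: "{p1, z2, z3, z4} \<subseteq> X - LX" "p1 \<notin> {z2, z3, z4}" using p z2(1) R(1) by auto
  have Y: "y1 \<in> Y" "y2 \<in> Y" and XX: "{p1, z2, z3, z4} \<subseteq> X" using y mem by auto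
  note found = that
  have close: thesis if "E y z" "E z y" "E z y' \<or> E y' z" "z \<in> {z2, z3, z4}" "{y, y'} = {y1, y2}" for y z y'
  proof -
    have yy: "y = y1 \<and> y' = y2 \<or> y = y2 \<and> y' = y1" using that(5) by (auto simp: doubleton_eq_iff)
    have "cyc E [p1, y, z, y'] \<or> cyc E [p1, y', z, y]"
      using four_cycle_from_path[of p1 y y' z] that yy y1(2,3) y2 Y XX mem(2) by blast
    then show thesis using found that(4) yy y mem(1) by blast
  qed
  show thesis
  proof (cases "E z2 y2 \<or> E y2 z2")
    case True
    then show thesis using close[of y1 z2 y2] z2 by auto
  next
    case False
    \<comment> \<open>The nonadjacent \<open>z2\<close> costs \<open>y2\<close> both misses, so
      \<open>y2\<close> has two-way edges to \<open>z3\<close> and \<open>z4\<close>. As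
      \<open>y1\<close> is adjacent to one of these, the roles of \<open>y1\<close> and
      \<open>y2\<close> can be exchanged.\<close>
    then have s: "E y2 z3" "E z3 y2" "E y2 z4" "E z4 y2"
      using dominating_bipartite.nonadjacent_high[OF swap y(2), of z2] R mem by auto
    have "E y1 z3 \<or> E z3 y1 \<or> E y1 z4 \<or> E z4 y1"
      using budget_Y(2)[OF y(1), of z3 z4 z3] R mem by auto
    then show thesis using close[of y2 z3 y1] close[of y2 z4 y1] s by auto
  qed
qed

text \<open>The partner \<open>y\<close> is excepted in \<open>blocked_four_cycle\<close>. With two
  partners \<open>y3\<close>, \<open>y4\<close> off the cycle the exception disappears, since
  \<open>v\<close> differs from one of them.\<close>

lemma saturated_outside_four_cycle:
  assumes no: "\<nexists>c. cyc E c \<and> length c = 6"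
    and c: "cyc E [z1, y1, z2, y2]" and mem: "z1 \<in> X" "z2 \<in> X" "y1 \<in> Y" "y2 \<in> Y"
    and z: "z \<in> X - LX" "z \<noteq> z1" "z \<noteq> z2" and y: "{y3, y4} \<subseteq> Y - LY" "distinct [y1, y2, y3, y4]"
    and v: "v \<in> Y" "v \<noteq> y1" "v \<noteq> y2"
  shows "E z v \<and> E v z"
  using blocked_four_cycle(1)[OF no c mem z, of y3 v] blocked_four_cycle(1)[OF no c mem z, of y4 v] y v
  by auto

text \<open>Without a 6-cycle, high vertices off the first 4-cycle form a second one, which in turn
  constrains the first. Every vertex of \<open>Y\<close> outside both is then joined both ways to
  \<open>z1\<close>, \<open>z2\<close>, \<open>z3\<close>, \<open>z4\<close>, which is too much for
  a high vertex and for a low one.\<close>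

lemma six_cycle:
  assumes low: "card LX \<le> 1" "card LY \<le> 1"
  shows "\<exists>c. cyc E c \<and> length c = 6"
proof (rule ccontr)
  assume no: "\<nexists>c. cyc E c \<and> length c = 6"
  have fl: "finite LX" "finite LY" using fin low_sub finite_subset by auto
  have card4: "4 \<le> card (X - LX)" "4 \<le> card (Y - LY)"
    using low a card_X card_Y low_sub fl by (simp_all add: card_Diff_subset)
  obtain z1 y1 z2 y2 where c: "cyc E [z1, y1, z2, y2]" and z12: "{z1, z2} \<subseteq> X - LX" and y12: "{y1, y2} \<subseteq> Y - LY"
    using four_cycle card4 by metis
  have d: "z1 \<noteq> z2" "y1 \<noteq> y2" using c by (auto simp: cyc_def)
  have two: "\<exists>u v. {u, v} \<subseteq> S - {p, q} \<and> u \<noteq> v" if "4 \<le> card S" "finite S" "{p, q} \<subseteq> S" "p \<noteq> q" for S and p q :: 'v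
  proof -
    have "card (S - {p, q}) = card S - 2" using that by (subst card_Diff_subset) auto
    then have "\<not> card (S - {p, q}) \<le> Suc 0" using that(1) by simp
    then show ?thesis using card_le_Suc0_iff_eq[of "S - {p, q}"] that(2) by auto
  qed
  obtain z3 z4 where z34: "{z3, z4} \<subseteq> X - LX - {z1, z2}" "z3 \<noteq> z4"
    using two[of "X - LX" z1 z2] card4 z12 d fin by auto
  obtain y3 y4 where y34: "{y3, y4} \<subseteq> Y - LY - {y1, y2}" "y3 \<noteq> y4"
    using two[of "Y - LY" y1 y2] card4 y12 d fin by auto
  have s34: "E z v \<and> E v z" if "z \<in> {z3, z4}" "v \<in> Y" "v \<noteq> y1" "v \<noteq> y2" for z v
    using saturated_outside_four_cycle[OF no c, of z y3 y4 v] z12 y12 d z34 y34 that by auto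
  have c': "cyc E [z3, y3, z4, y4]"
    using s34 y34 z34 disj by (auto simp: cyc_def)
  have s12: "E z v \<and> E v z" if "z \<in> {z1, z2}" "v \<in> Y" "v \<noteq> y3" "v \<noteq> y4" for z v
    using saturated_outside_four_cycle[OF no c', of z y1 y2 v] z12 y12 d z34 y34 that by auto
  have "card {y1, y2, y3, y4} = 4" using y34 d by auto
  then have "\<not> Y \<subseteq> {y1, y2, y3, y4}" using card_mono[of "{y1, y2, y3, y4}" Y] a card_Y by auto
  have full: "E z v \<and> E v z" if "z \<in> {z1, z2, z3, z4}" "v \<in> Y - {y1, y2, y3, y4}" for z v
    using s12 s34 that by auto
  have hY: "Y - LY \<subseteq> {y1, y2, y3, y4}"
  proof
    fix v assume v: "v \<in> Y - LY"
    show "v \<in> {y1, y2, y3, y4}"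
    proof (rule ccontr)
      assume n: "v \<notin> {y1, y2, y3, y4}"
      \<comment> \<open>Seen from the other side, \<open>v\<close> and \<open>z3\<close> are a high
        pair off the first 4-cycle, so \<open>v\<close> would have to miss an arc at
        \<open>z1\<close>, \<open>z2\<close> or \<open>z3\<close>.\<close>
      have "cyc E [y1, z2, y2, z1]" using cyc_rotate[OF c, of 1] by simp
      then have "\<exists>u \<in> {z2, z1, z3}. \<not> E v u \<or> \<not> E u v"
        using dominating_bipartite.blocked_four_cycle(2)[OF swap no, of y1 z2 y2 z1 v z3] z12 y12 z34 v n
        by auto
      then show False using full[of _ v] v n by auto
    qed
  qed
  obtain w where w: "w \<in> LY" "w \<notin> {y1, y2, y3, y4}" using hY \<open>\<not> Y \<subseteq> _\<close> by auto
  have "card Y \<le> card ({y1, y2, y3, y4} \<union> LY)" using hY fl by (intro card_mono) auto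
  also have "\<dots> \<le> card {y1, y2, y3, y4} + card LY" by (rule card_Un_le)
  finally have "card X = 5" using \<open>card {y1, y2, y3, y4} = 4\<close> low a card_X card_Y by simp
  moreover have "card {z1, z2, z3, z4} = 4" using z34 d by auto
  ultimately have "card (X - {z1, z2, z3, z4}) = 1"
    using z12 z34 by (subst card_Diff_subset) auto
  then obtain x where x: "X - {z1, z2, z3, z4} = {x}" by (auto simp: card_1_singleton_iff)
  \<comment> \<open>Since \<open>a = 5\<close>, only \<open>x\<close> lies outside the two 4-cycles
    on this side. The misses of the low vertex \<open>w\<close> cannot all be at
    \<open>x\<close>.\<close>
  then obtain x' where "x' \<in> X - {x}" "\<not> E w x' \<or> \<not> E x' w" using few_Y[OF w(1), of x] by auto
  then show False using full[of x' w] x w low_sub by auto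
qed

lemma even_pancyclic_few_low:
  assumes "card LX \<le> 1" "card LY \<le> 1"
  shows even_pancyclic
proof -
  obtain c where c: "cyc E c" "length c = 2 * 3" using six_cycle[OF assms] by auto
  have "finite LX" "finite LY" using fin low_sub finite_subset by auto
  then have "good c"
    using assms c card_le_Suc0_iff_eq[of LX] card_le_Suc0_iff_eq[of LY] by (auto simp: good_def)
  then show ?thesis using even_pancyclic_if_good[of c 3] c(2) a by auto
qed

end

section \<open>Two low vertices on one side\<close>

lemma obtain_three:
  assumes "finite S" "3 \<le> card S"
  obtains p q r where "distinct [p, q, r]" "{p, q, r} \<subseteq> S"
proof -
  obtain xs where "distinct xs" "length xs = 3" "set xs \<subseteq> S" using obtain_distinct_list[OF assms] .
  then show thesis using that by (auto simp: numeral_eq_Suc length_Suc_conv)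
qed

context dominating_bipartite
begin

lemma out_neighbour:
  assumes "S \<subseteq> X \<union> Y" "u \<in> S" "v \<in> X \<union> Y" "v \<notin> S"
  obtains p q where "p \<in> S" "q \<notin> S" "E p q"
  using strong[OF assms(1)] assms by blast

text \<open>One of the two permitted misses of \<open>y\<close> is always spent on a low vertex.\<close>

lemma one_defect:
  assumes LX: "LX = {x1, x2}" "x1 \<noteq> x2" and y: "y \<in> Y - LY"
  shows "u \<in> X \<Longrightarrow> v \<in> X \<Longrightarrow> u \<noteq> v \<Longrightarrow> E y u \<or> E y v"
    and "u \<in> X \<Longrightarrow> v \<in> X - LX \<Longrightarrow> E y u \<or> E v y"
    and "u \<in> X - LX \<Longrightarrow> v \<in> X - LX \<Longrightarrow> u \<noteq> v \<Longrightarrow> E u y \<or> E v y"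
    and "u \<in> X \<Longrightarrow> E y u \<or> E x1 y \<or> E x2 y"
    and "v \<in> X - LX \<Longrightarrow> E v y \<or> E x1 y \<or> E x2 y"
proof -
  have x: "x1 \<in> X" "x2 \<in> X" using LX low_sub by auto
  obtain x where x: "x \<in> X" "x \<in> LX" "\<not> E x y" using low_X[of x1 x2 y] LX x by blast
  show "u \<in> X \<Longrightarrow> v \<in> X \<Longrightarrow> u \<noteq> v \<Longrightarrow> E y u \<or> E y v"
    using budget_Y(2)[OF y, of u v x] x by auto
  show "u \<in> X \<Longrightarrow> v \<in> X - LX \<Longrightarrow> E y u \<or> E v y"
    using budget_Y(3)[OF y, of v x u] x by auto
  show "u \<in> X - LX \<Longrightarrow> v \<in> X - LX \<Longrightarrow> u \<noteq> v \<Longrightarrow> E u y \<or> E v y"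
    using budget_Y(4)[OF y, of u v x] x by auto
  show "u \<in> X \<Longrightarrow> E y u \<or> E x1 y \<or> E x2 y"
    using budget_Y(3)[OF y, of x1 x2 u] LX low_sub by auto
  show "v \<in> X - LX \<Longrightarrow> E v y \<or> E x1 y \<or> E x2 y"
    using budget_Y(4)[OF y, of v x1 x2] LX low_sub by auto
qed

lemma even_pancyclic_six:
  assumes "good [u1, u2, u3, u4, u5, u6]"
  shows even_pancyclic
  using even_pancyclic_if_good[OF assms, of 3] a by simp

lemma side_distinct: "u \<in> X \<Longrightarrow> v \<in> Y \<Longrightarrow> u \<noteq> v \<and> v \<noteq> u"
  using disj by auto

lemma card_high_ge:
  assumes "LX = {x1, x2}" "x1 \<noteq> x2"
  shows "3 \<le> card (X - LX)"
  using assms a card_X low_sub fin by (simp add: card_Diff_subset)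

text \<open>\<open>x1\<close> can be left only through low vertices of \<open>Y\<close>, and this
  helps: a cycle through \<open>x1\<close> and one of them omits at most one low vertex per side.
  Two high in-neighbours of \<open>x1\<close> leave a choice for the return.\<close>

lemma two_low_no_high_out:
  assumes LX: "LX = {x1, x2}" "x1 \<noteq> x2" and LY: "card LY \<le> 2"
    and next_y: "\<And>z y. z \<in> X - LX \<Longrightarrow> y \<in> Y - LY \<Longrightarrow> \<exists>y' \<in> Y - LY. y' \<noteq> y \<and> E z y'"
    and yA: "yA \<in> Y - LY" "E yA x1" and yB: "yB \<in> Y - LY" "E yB x1" and AB: "yA \<noteq> yB"
    and no_out: "\<And>y. y \<in> Y - LY \<Longrightarrow> \<not> E x1 y"
  shows even_pancyclic
proof -
  have low: "x1 \<in> X" "x2 \<in> X" "x1 \<in> LX" "x2 \<in> LX" using LX low_sub by auto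
  have fLY: "finite LY" using fin low_sub finite_subset by auto
  have out1: "w \<in> LY" if "E x1 w" for w using no_out that arcD1[OF that] low by blast
  note D = one_defect[OF LX]
  have good6: "good c" if "cyc E c" "x1 \<in> set c" "w \<in> LY" "w \<in> set c" for c w
  proof -
    have "card (LY - {w}) \<le> 1" using LY that(3) by (simp add: card_Diff_singleton)
    then have "\<forall>u \<in> LY - {w}. \<forall>v \<in> LY - {w}. u = v"
      using card_le_Suc0_iff_eq[of "LY - {w}"] fLY by auto
    then show ?thesis using that LX unfolding good_def by blast
  qed
  show ?thesis
  proof (cases "\<exists>w z. E x1 w \<and> z \<in> X - LX \<and> E w z")
    case True
    then obtain w z where wz: "E x1 w" "z \<in> X - LX" "E w z" by blast
    have w: "w \<in> LY" "w \<in> Y" using out1 wz low_sub by auto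
    obtain y' where y': "y' \<in> Y - LY" "y' \<noteq> yA" "E z y'" using next_y wz yA by blast
    have cl: ?thesis if "p \<in> Y - LY" "q \<in> Y - LY" "p \<noteq> q" "E p x1" "E z q" "E q s" "E s p" "s \<in> X - LX" "s \<noteq> z"
      for p q s
    proof -
      have "cyc E [x1, w, z, q, s, p]"
        using that wz w low side_distinct by (auto simp: cyc_def)
      then show ?thesis using even_pancyclic_six[OF good6[OF _ _ w(1)]] by simp
    qed
    have "\<not> card (X - LX - {z}) \<le> Suc 0"
      using card_high_ge[OF LX] wz(2) fin by (simp add: card_Diff_singleton)
    then obtain s t where st: "s \<in> X - LX" "t \<in> X - LX" "s \<noteq> t" "s \<noteq> z" "t \<noteq> z"
      using card_le_Suc0_iff_eq[of "X - LX - {z}"] fin by auto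
    have stX: "s \<in> X" "t \<in> X" "z \<in> X" using st wz by auto
    show ?thesis
    proof (cases "E y' s \<and> E s yA \<or> E y' t \<and> E t yA")
      case True
      then show ?thesis using cl[of yA y' s] cl[of yA y' t] y' yA st by auto
    next
      case False
      \<comment> \<open>If neither \<open>s\<close> nor \<open>t\<close> works, \<open>y'\<close>
        has spent its remaining miss on the arc to one of them and \<open>yA\<close> on the arc from
        the other. All their further arcs are present, so \<open>y'\<close> and \<open>yA\<close>
        can exchange places.\<close>
      then obtain s' t' where s': "s' \<in> {s, t}" "t' \<in> {s, t}" "s' \<noteq> t'" "\<not> E y' s'" "\<not> E t' yA"
        using D(1)[OF y'(1), of s t] D(3)[OF yA(1), of s t] st stX by blast
      have m: "s' \<in> X - LX" "t' \<in> X - LX" "t' \<noteq> z" "s' \<noteq> z" using s' st by auto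
      have "E y' x1" using D(1)[OF y'(1), of s' x1] s' m low by auto
      moreover have "E z yA" using D(3)[OF yA(1), of t' z] s' m wz by auto
      moreover have "E yA s'" using D(2)[OF yA(1), of s' t'] s' m by auto
      moreover have "E s' y'" using D(2)[OF y'(1), of s' s'] s' m by auto
      ultimately show ?thesis using cl[of y' yA s'] y' yA m by auto
    qed
  next
    case False
    then have only_low: "p \<in> LX" if "E x1 w" "E w p" for w p
      using that out1[OF that(1)] low_sub arcD2[OF that(2)] by blast
    obtain w where w: "E x1 w" "E w x2"
    proof -
      \<comment> \<open>Two arcs from \<open>x1\<close> always lead into \<open>LX\<close>, so an
        arc leaving \<open>x1\<close> and its out-neighbours must end in \<open>x2\<close>.\<close>
      obtain p q where pq: "p \<in> insert x1 {w. E x1 w}" "q \<notin> insert x1 {w. E x1 w}" "E p q"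
        using out_neighbour[of "insert x1 {w. E x1 w}" x1 x2] low arcs LX(2) disj arcD1[of x1 x2] by blast
      then have "E x1 p" by auto
      then have "q = x2" using only_low[of p q] pq LX by auto
      then show thesis using that \<open>E x1 p\<close> pq by blast
    qed
    have wL: "w \<in> LY" "w \<in> Y" using out1 w low_sub by auto
    show ?thesis
    proof (cases "\<exists>y \<in> Y - LY. E x2 y")
      case True
      then obtain y' where y': "y' \<in> Y - LY" "E x2 y'" by blast
      obtain y where y: "y \<in> Y - LY" "E y x1" "y \<noteq> y'" using yA yB AB by blast
      obtain p q r where pqr: "distinct [p, q, r]" "{p, q, r} \<subseteq> X - LX"
        using obtain_three card_high_ge[OF LX] fin by (metis finite_Diff)
      have "\<exists>z \<in> {p, q, r}. E y' z \<and> E z y"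
        using D(1)[OF y'(1), of p q] D(1)[OF y'(1), of p r] D(1)[OF y'(1), of q r]
          D(3)[OF y(1), of p q] D(3)[OF y(1), of p r] D(3)[OF y(1), of q r] pqr by auto
      then obtain z where z: "z \<in> X - LX" "E y' z" "E z y" using pqr(2) by blast
      have "cyc E [x1, w, x2, y', z, y]"
        using w y y' z low wL side_distinct LX by (auto simp: cyc_def)
      then show ?thesis using even_pancyclic_six[OF good6[OF _ _ wL(1)]] by simp
    next
      case False
      then have out2: "v \<in> LY" if "E x2 v" for v using that arcD1[OF that] low by blast
      obtain p w' where "p \<in> {x2}" "E p w'"
        using out_neighbour[of "{x2}" x2 x1] low LX(2) by blast
      then have w': "E x2 w'" by simp
      have w2: "w' \<in> LY" "w' \<noteq> w" using out2 w' low_X[of x1 x2 w] low w LX by auto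
      then have LYe: "LY = {w, w'}"
        using LY wL fLY by (metis card_2_iff card_mono card_seteq empty_subsetI insert_subset)
      \<comment> \<open>\<open>x1\<close> and \<open>x2\<close> lead only to low vertices and
        \<open>w\<close> only into \<open>LX\<close>; the exit from the low vertices is therefore
        \<open>w'\<close>.\<close>
      obtain p q where pq: "p \<in> LX \<union> LY" "q \<notin> LX \<union> LY" "E p q"
        using out_neighbour[of "LX \<union> LY" x1 yA] low_sub low yA disj by blast
      have "p = w'"
        using pq out1 out2 only_low[OF w(1)] LX LYe by blast
      then have q: "q \<in> X - LX" "E w' q" using pq arcD2[of w' q] w2(1) low_sub by auto
      \<comment> \<open>Neither \<open>x1\<close> nor \<open>x2\<close> dominates \<open>yA\<close>,
        which uses up both misses of \<open>yA\<close>.\<close>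
      have "E q yA" using D(5)[OF yA(1) q(1)] no_out[OF yA(1)] False yA by blast
      then have "cyc E [x1, w, x2, w', q, yA]"
        using w w' w2 q yA low wL LYe low_sub side_distinct LX by (auto simp: cyc_def)
      then show ?thesis using even_pancyclic_six[OF good6[OF _ _ wL(1)]] by simp
    qed
  qed
qed

text \<open>Each high vertex of \<open>Y\<close> dominates \<open>x1\<close> or \<open>x2\<close>,
  so one of these receives arcs from two of three. Two in-neighbours guarantee one that differs from
  a prescribed out-neighbour.\<close>

lemma two_low_in_neighbours:
  assumes LX: "LX = {x1, x2}" "x1 \<noteq> x2" and k: "3 \<le> card (Y - LY)"
  obtains x x' yA yB where "LX = {x, x'}" "x \<noteq> x'" "yA \<in> Y - LY" "yB \<in> Y - LY" "yA \<noteq> yB" "E yA x" "E yB x"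
proof -
  obtain p q r where pqr: "distinct [p, q, r]" "{p, q, r} \<subseteq> Y - LY"
    using obtain_three k fin by (metis finite_Diff)
  have "x1 \<in> X" "x2 \<in> X" using LX low_sub by auto
  then have "E p x1 \<or> E p x2" "E q x1 \<or> E q x2" "E r x1 \<or> E r x2"
    using one_defect(1)[OF LX, of _ x1 x2] pqr(2) LX(2) by auto
  moreover have "LX = {x2, x1}" using LX by auto
  ultimately show thesis
    using that[of x1 x2 p q] that[of x1 x2 p r] that[of x1 x2 q r]
      that[of x2 x1 p q] that[of x2 x1 p r] that[of x2 x1 q r] LX pqr by auto
qed

lemma even_pancyclic_two_one:
  assumes LX: "card LX = 2" and LY: "card LY \<le> 1"
  shows even_pancyclic
proof -
  have fLY: "finite LY" using fin low_sub finite_subset by auto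
  have k: "4 \<le> card (Y - LY)" using LY a card_Y low_sub fLY by (simp add: card_Diff_subset)
  then have k3: "3 \<le> card (Y - LY)" by simp
  obtain x1 x2 where x12: "LX = {x1, x2}" "x1 \<noteq> x2" using LX by (auto simp: card_2_iff)
  obtain x x' yA yB where L: "LX = {x, x'}" "x \<noteq> x'" and AB: "yA \<in> Y - LY" "yB \<in> Y - LY" "yA \<noteq> yB" "E yA x" "E yB x"
    using two_low_in_neighbours[OF x12 k3] .
  have xX: "x \<in> X" using L low_sub by auto
  show ?thesis
  proof (cases "\<exists>y1 \<in> Y - LY. E x y1")
    case False
    have "\<exists>y' \<in> Y - LY. y' \<noteq> y \<and> E z y'" if z: "z \<in> X - LX" and y: "y \<in> Y - LY" for z y
    proof -
      have "3 \<le> card (Y - LY - {y})" using k y fin by (simp add: card_Diff_singleton)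
      then obtain p q r where "distinct [p, q, r]" "{p, q, r} \<subseteq> Y - LY - {y}"
        using obtain_three fin by (metis finite_Diff)
      then show ?thesis using budget_X(1)[OF z, of p q r] by auto
    qed
    then show ?thesis using two_low_no_high_out[OF L _ _ AB(1,4,2,5,3)] LY False by auto
  next
    case True
    then obtain y1 where y1: "y1 \<in> Y - LY" "E x y1" by blast
    obtain y2 where y2: "y2 \<in> Y - LY" "E y2 x" "y2 \<noteq> y1" using AB by blast
    have "\<not> Y - LY \<subseteq> {y1, y2}" using k card_mono[of "{y1, y2}" "Y - LY"] y2(3) by auto
    then obtain y3 where y3: "y3 \<in> Y - LY" "y3 \<noteq> y1" "y3 \<noteq> y2" by blast
    obtain p q r where pqr: "distinct [p, q, r]" "{p, q, r} \<subseteq> X - LX"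
      using obtain_three card_high_ge[OF L] fin by (metis finite_Diff)
    note D = one_defect[OF L]
    have "E y1 p \<or> E y1 q" "E y1 p \<or> E y1 r" "E y1 q \<or> E y1 r"
      using D(1)[OF y1(1)] pqr by auto
    moreover have "E p y2 \<or> E q y2" "E p y2 \<or> E r y2" "E q y2 \<or> E r y2"
      using D(3)[OF y2(1)] pqr by auto
    moreover have "E y3 p \<or> E y3 q" "E y3 p \<or> E y3 r" "E y3 q \<or> E y3 r"
      using D(1)[OF y3(1)] pqr by auto
    moreover have "E p y3 \<or> E q y3" "E p y3 \<or> E r y3" "E q y3 \<or> E r y3"
      using D(3)[OF y3(1)] pqr by auto
    moreover have "E y3 u \<or> E v y3" if "u \<in> {p, q, r}" "v \<in> {p, q, r}" for u v
      using D(2)[OF y3(1), of u v] pqr that by auto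
    then have "E y3 p \<or> E p y3" "E y3 p \<or> E q y3" "E y3 p \<or> E r y3" "E y3 q \<or> E p y3" "E y3 q \<or> E q y3"
      "E y3 q \<or> E r y3" "E y3 r \<or> E p y3" "E y3 r \<or> E q y3" "E y3 r \<or> E r y3" by auto
    \<comment> \<open>The disjuncts are the six ordered pairs from \<open>p\<close>,
      \<open>q\<close>, \<open>r\<close>. \<open>y1\<close> can exclude one vertex as first entry,
      \<open>y2\<close> one as second entry, and the remaining miss of \<open>y3\<close> one vertex
      in one position; this never excludes all six.\<close>
    ultimately have
      "E y1 p \<and> E p y3 \<and> E y3 q \<and> E q y2 \<or> E y1 p \<and> E p y3 \<and> E y3 r \<and> E r y2 \<or>
       E y1 q \<and> E q y3 \<and> E y3 p \<and> E p y2 \<or> E y1 q \<and> E q y3 \<and> E y3 r \<and> E r y2 \<or>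
       E y1 r \<and> E r y3 \<and> E y3 p \<and> E p y2 \<or> E y1 r \<and> E r y3 \<and> E y3 q \<and> E q y2"
      by argo
    then have "\<exists>z \<in> {p, q, r}. \<exists>z' \<in> {p, q, r}. z \<noteq> z' \<and> E y1 z \<and> E z y3 \<and> E y3 z' \<and> E z' y2"
      using pqr(1) by auto
    then obtain z z' where z: "z \<in> X - LX" "z' \<in> X - LX" "z \<noteq> z'" "E y1 z" "E z y3" "E y3 z'" "E z' y2"
      using pqr(2) by blast
    have "cyc E [x, y1, z, y3, z', y2]"
      using y1 y2 y3 z xX side_distinct L by (auto simp: cyc_def)
    then have "good [x, y1, z, y3, z', y2]"
      using L LY card_le_Suc0_iff_eq[of LY] fLY unfolding good_def by auto
    then show ?thesis by (rule even_pancyclic_six)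
  qed
qed

lemma two_two_configuration:
  assumes L: "LX = {x, x'}" "LY = {w, w'}"
    and y: "y \<in> Y - LY" "y1 \<in> Y - LY" "y \<noteq> y1" "E x y1" "E y x"
    and z: "z \<in> X - LX" "z1 \<in> X - LX" "z \<noteq> z1" "E w z1" "E z w" and "E y1 z" "E z1 y"
  shows even_pancyclic
proof -
  have "x \<in> X" "w \<in> Y" using L low_sub by auto
  then have "cyc E [x, y1, z, w, z1, y]"
    using assms side_distinct by (auto simp: cyc_def)
  then have "good [x, y1, z, w, z1, y]" using L unfolding good_def by auto
  then show ?thesis by (rule even_pancyclic_six)
qed

text \<open>If \<open>y1\<close> misses \<open>z\<close>, then neither has another defect, so \<open>z\<close> has a low in-neighbour and can
  take over the role of \<open>z1\<close>.\<close>

lemma two_two_defect: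
  assumes LX: "LX = {x, x'}" "x \<noteq> x'" and LY: "LY = {w, w'}" "w \<noteq> w'"
    and y: "y \<in> Y - LY" "y1 \<in> Y - LY" "y \<noteq> y1" "E x y1" "E y x"
    and z1: "z1 \<in> X - LX" "E w z1"
    and z: "zA \<in> X - LX" "zB \<in> X - LX" "zA \<noteq> zB" "E zA w" "E zB w"
    and no: "\<And>z. z \<in> X - LX \<Longrightarrow> z \<noteq> z1 \<Longrightarrow> E z w \<Longrightarrow> \<not> E y1 z"
  shows even_pancyclic
proof -
  note D = one_defect[OF LX] and D' = dominating_bipartite.one_defect[OF swap LY]
  have w: "w \<in> Y" "w' \<in> Y" using LY low_sub by auto
  obtain z where z': "z \<in> X - LX" "z \<noteq> z1" "E z w" using z by blast
  then have n: "\<not> E y1 z" using no by auto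
  have only: "u = z \<or> u = z1" if "u \<in> X - LX" "E u w" for u
    using D(1)[OF y(2), of u z] no[OF that(1) _ that(2)] n z' that by auto
  then have "E z1 w" using z by blast
  have "E y1 u" if "u \<in> X - LX" "u \<noteq> z" for u
    using D(1)[OF y(2), of u z] n z' that by auto
  moreover have "E z y" using D'(2)[OF z'(1), of y y1] n y by auto
  moreover have "E w z \<or> E w' z" using D'(5)[OF z'(1) y(2)] n by auto
  moreover have "\<not> X - LX \<subseteq> {z, z1}"
    using card_high_ge[OF LX] card_mono[of "{z, z1}" "X - LX"] z'(2) by auto
  then obtain z3 where z3: "z3 \<in> X - LX" "z3 \<noteq> z" "z3 \<noteq> z1" by blast
  moreover have "E z3 w'" using D'(1)[OF z3(1) w LY(2)] only z3 by auto
  moreover have "LY = {w', w}" using LY by auto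
  \<comment> \<open>If \<open>w\<close> dominates \<open>z\<close>, then \<open>z\<close> and
    \<open>z1\<close> exchange roles. If \<open>w'\<close> does, it replaces \<open>w\<close> and is
    entered from \<open>z3\<close>, which does not dominate \<open>w\<close> and hence dominates
    \<open>w'\<close>.\<close>
  ultimately show ?thesis
    using two_two_configuration[OF LX(1) LY(1) y z1(1) z'(1)]
      two_two_configuration[OF LX(1) \<open>LY = {w', w}\<close> y z3(1) z'(1) z3(2)]
      two_two_configuration[OF LX(1) LY(1) y z1(1) z'(1) z'(2)[symmetric]] \<open>E z1 w\<close> z1 z'(2) by blast
qed

text \<open>\<open>x\<close> and \<open>w\<close> are chosen with two high in-neighbours each. When
  both also have a high out-neighbour, the configuration needs an in-neighbour of \<open>w\<close>
  dominated by \<open>y1\<close> and an in-neighbour of \<open>x\<close> dominated by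
  \<open>z1\<close>. Failure of either is the defect treated above, up to exchanging the
  sides.\<close>

lemma even_pancyclic_two_two:
  assumes "card LX = 2" "card LY = 2"
  shows even_pancyclic
proof -
  obtain x1 x2 w1 w2 where x12: "LX = {x1, x2}" "x1 \<noteq> x2" and w12: "LY = {w1, w2}" "w1 \<noteq> w2"
    using assms by (auto simp: card_2_iff)
  then have k: "3 \<le> card (X - LX)" "3 \<le> card (Y - LY)"
    using card_high_ge dominating_bipartite.card_high_ge[OF swap] by blast+
  obtain x x' yA yB where LX: "LX = {x, x'}" "x \<noteq> x'" and
    y: "yA \<in> Y - LY" "yB \<in> Y - LY" "yA \<noteq> yB" "E yA x" "E yB x"
    using two_low_in_neighbours[OF x12 k(2)] .
  obtain w w' zA zB where LY: "LY = {w, w'}" "w \<noteq> w'" and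
    z: "zA \<in> X - LX" "zB \<in> X - LX" "zA \<noteq> zB" "E zA w" "E zB w"
    using dominating_bipartite.two_low_in_neighbours[OF swap w12 k(1)] .
  have nextX: "\<exists>z' \<in> X - LX. z' \<noteq> z \<and> E y z'" if "y \<in> Y - LY" "z \<in> X - LX" for y z
  proof -
    have "\<not> card (X - LX - {z}) \<le> Suc 0" using k that fin by (simp add: card_Diff_singleton)
    then obtain p q where "p \<in> X - LX - {z}" "q \<in> X - LX - {z}" "p \<noteq> q"
      using card_le_Suc0_iff_eq[of "X - LX - {z}"] fin by auto
    then show ?thesis using one_defect(1)[OF LX that(1), of p q] by auto
  qed
  have nextY: "\<exists>y' \<in> Y - LY. y' \<noteq> y \<and> E z y'" if "z \<in> X - LX" "y \<in> Y - LY" for y z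
  proof -
    have "\<not> card (Y - LY - {y}) \<le> Suc 0" using k that fin by (simp add: card_Diff_singleton)
    then obtain p q where "p \<in> Y - LY - {y}" "q \<in> Y - LY - {y}" "p \<noteq> q"
      using card_le_Suc0_iff_eq[of "Y - LY - {y}"] fin by auto
    then show ?thesis using dominating_bipartite.one_defect(1)[OF swap LY that(1), of p q] by auto
  qed
  show ?thesis
  proof (cases "(\<exists>y1 \<in> Y - LY. E x y1) \<and> (\<exists>z1 \<in> X - LX. E w z1)")
    case False
    then show ?thesis
      using two_low_no_high_out[OF LX _ nextY y(1,4,2,5,3)] assms
        dominating_bipartite.two_low_no_high_out[OF swap LY _ nextX z(1,4,2,5,3)] swap_even_pancyclic
      by fastforce
  next
    case True
    then obtain y1 z1 where y1: "y1 \<in> Y - LY" "E x y1" and z1: "z1 \<in> X - LX" "E w z1" by blast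
    show ?thesis
    proof (cases "\<exists>z \<in> X - LX. z \<noteq> z1 \<and> E z w \<and> E y1 z")
      case False
      obtain y where "y \<in> Y - LY" "y \<noteq> y1" "E y x" using y by blast
      then show ?thesis using two_two_defect[OF LX LY _ y1(1) _ y1(2) _ z1 z] False by blast
    next
      case t: True
      show ?thesis
      proof (cases "\<exists>y \<in> Y - LY. y \<noteq> y1 \<and> E y x \<and> E z1 y")
        case True
        then show ?thesis using t two_two_configuration[OF LX(1) LY(1)] y1 z1 by blast
      next
        case False
        obtain z where "z \<in> X - LX" "z \<noteq> z1" "E z w" using z by blast
        then show ?thesis
          using dominating_bipartite.two_two_defect[OF swap LY LX _ z1(1) _ z1(2) _ y1 y] False
            swap_even_pancyclic by blast
      qed
    qed
  qed
qed


section \<open>Three low vertices on one side\<close>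

lemma goodI:
  assumes "cyc E c" "A \<subseteq> LX" "A \<subseteq> set c" "card LX \<le> Suc (card A)"
    and "B \<subseteq> LY" "B \<subseteq> set c" "card LY \<le> Suc (card B)"
  shows "good c"
proof -
  have f: "finite LX" "finite LY" using fin low_sub finite_subset by auto
  have *: "u = v" if "finite L" "C \<subseteq> L" "C \<subseteq> S" "card L \<le> Suc (card C)" "u \<in> L - S" "v \<in> L - S"
    for L C S :: "'v set" and u v
  proof -
    have "card (L - C) \<le> Suc 0" using that by (simp add: card_Diff_subset finite_subset)
    then show ?thesis using card_le_Suc0_iff_eq[of "L - C"] that by auto
  qed
  show ?thesis
    unfolding good_def
    using assms *[OF f(1) assms(2,3,4)] *[OF f(2) assms(5,6,7)] by blast
qed

text \<open>For \<open>a = 5\<close> an 8-cycle already has length \<open>2 * a - 2\<close>, so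
  growth does not pass through length \<open>2 * a - 4\<close>. The additional 6-cycle fills this
  gap.\<close>

lemma eight_six:
  assumes "good [u1, u2, u3, u4, u5, u6, u7, u8]" "cyc E [v1, v2, v3, v4, v5, v6]"
    and "v \<in> (X - LX) \<union> (Y - LY)" "v \<notin> {v1, v2, v3, v4, v5, v6}"
  shows even_pancyclic
proof (cases "a = 5")
  case True
  show ?thesis
  proof (rule even_pancyclicI[OF _ _ assms(2) _ assms(3)])
    show "cyc E [u1, u2, u3, u4, u5, u6, u7, u8]" using assms(1) by (simp only: good_def)
  qed (use assms(4) True in simp_all)
next
  case False
  then show ?thesis using even_pancyclic_if_good[OF assms(1), of 4] a by simp
qed

lemma low_mem: "u \<in> LX \<Longrightarrow> u \<in> X" "u \<in> LY \<Longrightarrow> u \<in> Y"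
  using low_sub by auto

lemma some_high: "\<exists>z. z \<in> X - LX"
  using card_high(1) by (metis card.empty ex_in_conv not_numeral_le_zero)

lemma out_exists:
  assumes "u \<in> X \<union> Y"
  obtains v where "E u v" "v \<noteq> u"
proof -
  obtain p q where "p \<in> X" "q \<in> Y"
    using a card_X card_Y by (metis card.empty ex_in_conv not_numeral_le_zero)
  then have "p \<in> X \<union> Y" "q \<in> X \<union> Y" "p \<noteq> q" using disj by auto
  then obtain w where "w \<in> X \<union> Y" "w \<noteq> u" by metis
  then show thesis using out_neighbour[of "{u}" u w] assms that by blast
qed

text \<open>At most one of the three low vertices dominates \<open>y\<close>, so two others account
  for both misses of \<open>y\<close>, and no further arc at \<open>y\<close> is missing.\<close>

lemma three_low:
  assumes LX: "card LX = 3" and y: "y \<in> Y - LY"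
  shows "u \<in> X \<Longrightarrow> E y u" and "v \<in> X - LX \<Longrightarrow> E v y" and "\<exists>x \<in> LX. E x y"
proof -
  obtain p q r where pqr: "LX = {p, q, r}" "p \<noteq> q" "p \<noteq> r" "q \<noteq> r" using LX by (auto simp: card_3_iff)
  have m: "p \<in> X" "q \<in> X" "r \<in> X" using pqr low_sub by auto
  show "\<exists>x \<in> LX. E x y" using budget_Y(4)[OF y, of p q r] pqr m by auto
  have "\<not> E p y \<and> \<not> E q y \<or> \<not> E p y \<and> \<not> E r y \<or> \<not> E q y \<and> \<not> E r y"
    using low_X[of p q y] low_X[of p r y] low_X[of q r y] pqr by auto
  then obtain s t where st: "s \<in> LX" "t \<in> LX" "s \<noteq> t" "\<not> E s y" "\<not> E t y" using pqr by blast
  then show "u \<in> X \<Longrightarrow> E y u" using budget_Y(3)[OF y, of s t u] low_sub by auto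
  show "v \<in> X - LX \<Longrightarrow> E v y" using budget_Y(4)[OF y, of s t v] low_sub st by auto
qed

lemma low_without_high_out:
  assumes "x \<in> LX" "\<And>y. y \<in> Y - LY \<Longrightarrow> \<not> E x y" "E x w"
  shows "w \<in> LY"
  using assms arcD1[OF assms(3)] low_sub by blast

lemma another_high:
  assumes "y \<in> Y - LY"
  obtains y' where "y' \<in> Y - LY" "y' \<noteq> y"
proof -
  have "\<not> card (Y - LY) \<le> Suc 0" using card_high(2) by simp
  then show thesis using card_le_Suc0_iff_eq[of "Y - LY"] fin that by (metis finite_Diff)
qed

lemma third_high:
  assumes "3 \<le> card (Y - LY)"
  obtains y' where "y' \<in> Y - LY" "y' \<noteq> p" "y' \<noteq> q"
proof -
  have "card {p, q} \<le> 2" by (simp add: card_insert_if)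
  then have "\<not> Y - LY \<subseteq> {p, q}" using assms card_mono[of "{p, q}" "Y - LY"] by auto
  then show thesis using that by blast
qed

text \<open>Two low vertices of \<open>X\<close> without high out-neighbours would both dominate the
  only low vertex of \<open>Y\<close>. So two of the three have high out-neighbours, necessarily
  different ones, and \<open>three_low\<close> supplies the other arcs of the cycle.\<close>

lemma even_pancyclic_three_one:
  assumes LX: "card LX = 3" and LY: "card LY \<le> 1"
  shows even_pancyclic
proof -
  have fLY: "finite LY" using fin low_sub finite_subset by auto
  have k: "3 \<le> card (Y - LY)" using LY a card_Y low_sub fLY by (simp add: card_Diff_subset)
  have LYeq: "u = v" if "u \<in> LY" "v \<in> LY" for u v using LY fLY card_le_Suc0_iff_eq[of LY] that by auto
  obtain p q r where pqr: "LX = {p, q, r}" "p \<noteq> q" "p \<noteq> r" "q \<noteq> r" using LX by (auto simp: card_3_iff)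
  have nn: "(\<exists>y \<in> Y - LY. E s y) \<or> (\<exists>y \<in> Y - LY. E t y)" if st: "s \<in> LX" "t \<in> LX" "s \<noteq> t" for s t
  proof (rule ccontr)
    assume "\<not> ?thesis"
    moreover obtain u v where "E s u" "E t v" using out_exists st low_sub by (metis UnI1 subsetD)
    ultimately show False
      using LYeq[of u v] low_without_high_out[of s u] low_without_high_out[of t v] st low_X[of s t u] by auto
  qed
  then have "(\<exists>y \<in> Y - LY. E p y) \<and> (\<exists>y \<in> Y - LY. E q y) \<or> (\<exists>y \<in> Y - LY. E p y) \<and> (\<exists>y \<in> Y - LY. E r y) \<or>
    (\<exists>y \<in> Y - LY. E q y) \<and> (\<exists>y \<in> Y - LY. E r y)"
    using nn[of p q] nn[of p r] nn[of q r] pqr by blast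
  then obtain s t y1 y2 where st: "s \<in> LX" "t \<in> LX" "s \<noteq> t" and y: "y1 \<in> Y - LY" "E s y1" "y2 \<in> Y - LY" "E t y2"
    using pqr by blast
  have ne: "y1 \<noteq> y2" using low_X[of s t y1] st y by auto
  obtain y3 where y3: "y3 \<in> Y - LY" "y3 \<noteq> y1" "y3 \<noteq> y2" using third_high[OF k] .
  obtain z where z: "z \<in> X - LX" using some_high by blast
  have "cyc E [s, y1, t, y2, z, y3]"
    using st y y3 z ne three_low[OF LX] low_mem side_distinct by (auto simp: cyc_def)
  then have "good [s, y1, t, y2, z, y3]"
    by (rule goodI[of _ "{s, t}" "{}"]) (use st LX LY in auto)
  then show ?thesis by (rule even_pancyclic_six)
qed

text \<open>The names follow \<open>D(10)\<close>, with either partite set in the role of its \<open>X\<close>.\<close>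

definition ten_vertex_exception :: bool where
  "ten_vertex_exception \<longleftrightarrow> (\<exists>x0 x1 x2 x3 x4 y0 y1 y2 y3 y4.
    distinct [x0, x1, x2, x3, x4, y0, y1, y2, y3, y4] \<and>
    X \<union> Y = {x0, x1, x2, x3, x4, y0, y1, y2, y3, y4} \<and>
    (\<forall>u v. E u v \<longleftrightarrow> (u, v) \<in> {x1, x2, x3} \<times> {y0, y1, y2, y3, y4} \<union> {y0, y1} \<times> {x1, x2, x3} \<union>
      {(y2, x1), (y3, x2), (y4, x3), (x0, y0), (y0, x0), (x4, y1), (y1, x4)}))"

text \<open>For \<open>card LY = 2\<close> the cycle has to contain two low vertices of
  \<open>X\<close> and one of \<open>Y\<close>. This lemma and the next two treat the positions of
  \<open>w\<close> on it: from low to high, from high to low, and between two high vertices.\<close>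

lemma three_low_via_low_Y:
  assumes LX: "card LX = 3" and LY: "card LY \<le> 2"
    and x: "x \<in> LX" "x' \<in> LX" "x \<noteq> x'" and w: "w \<in> LY" "E x w" "E w z" "z \<in> X - LX"
    and y: "y \<in> Y - LY" "E x' y"
  shows even_pancyclic
proof -
  obtain y' where y': "y' \<in> Y - LY" "y' \<noteq> y" using another_high y(1) by blast
  have "cyc E [x, w, z, y', x', y]"
    using assms y' three_low[OF LX] low_mem side_distinct by (auto simp: cyc_def)
  then have "good [x, w, z, y', x', y]"
    by (rule goodI[of _ "{x, x'}" "{w}"]) (use assms in auto)
  then show ?thesis by (rule even_pancyclic_six)
qed

lemma three_low_from_low_Y:
  assumes LX: "card LX = 3" and LY: "card LY \<le> 2"
    and x: "x \<in> LX" "x' \<in> LX" "x \<noteq> x'" and w: "w \<in> LY" "E z w" "z \<in> X - LX" "E w x"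
    and y: "y \<in> Y - LY" "E x y" "y' \<in> Y - LY" "E x' y'"
  shows even_pancyclic
proof -
  have "y \<noteq> y'" using low_X x y by blast
  then have "cyc E [z, w, x, y, x', y']"
    using assms three_low[OF LX] low_mem side_distinct by (auto simp: cyc_def)
  then have "good [z, w, x, y, x', y']"
    by (rule goodI[of _ "{x, x'}" "{w}"]) (use assms in auto)
  then show ?thesis by (rule even_pancyclic_six)
qed

text \<open>As \<open>w\<close> is now entered and left through high vertices, the cycle needs eight
  vertices. Cutting out \<open>z'\<close> and \<open>w\<close> gives the 6-cycle required by
  \<open>eight_six\<close>.\<close>

lemma three_low_between_high:
  assumes LX: "card LX = 3" and LY: "card LY \<le> 2"
    and x: "x \<in> LX" "x' \<in> LX" "x \<noteq> x'" 
    and w: "w \<in> LY" "E z' w" "z' \<in> X - LX" "E w z" "z \<in> X - LX" "z \<noteq> z'"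
    and y: "y \<in> Y - LY" "E x y" "y' \<in> Y - LY" "E x' y'"
  shows even_pancyclic
proof -
  have fLY: "finite LY" using fin low_sub finite_subset by auto
  have k: "3 \<le> card (Y - LY)" using LY a card_Y low_sub fLY by (simp add: card_Diff_subset)
  have "y \<noteq> y'" using low_X x y by blast
  obtain y3 where y3: "y3 \<in> Y - LY" "y3 \<noteq> y" "y3 \<noteq> y'" using third_high[OF k] .
  have "cyc E [x, y, x', y', z', w, z, y3]"
    using assms y3 \<open>y \<noteq> y'\<close> three_low[OF LX] low_mem side_distinct by (auto simp: cyc_def)
  then have "good [x, y, x', y', z', w, z, y3]"
    by (rule goodI[of _ "{x, x'}" "{w}"]) (use assms in auto)
  moreover have "cyc E [x, y, x', y', z, y3]"
    using assms y3 \<open>y \<noteq> y'\<close> three_low[OF LX] low_mem side_distinct by (auto simp: cyc_def)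
  moreover have "z' \<notin> {x, y, x', y', z, y3}" using w x y y3 side_distinct[of z'] by auto
  ultimately show ?thesis using eight_six w(3) by blast
qed


text \<open>The low vertices other than \<open>x1\<close> continue to different vertices of
  \<open>LY\<close> and so occupy all of it. If \<open>LY\<close> has no arc to a high vertex,
  strong connectivity forces an arc from it to \<open>x1\<close>, and that arc lies on a suitable
  cycle.\<close>

lemma three_two_one_entry:
  assumes LX: "card LX = 3" and LY: "card LY = 2"
    and x: "x1 \<in> LX" and y: "y1 \<in> Y - LY" "E x1 y1"
    and single: "\<And>x y. x \<in> LX \<Longrightarrow> x \<noteq> x1 \<Longrightarrow> y \<in> Y - LY \<Longrightarrow> \<not> E x y"
  shows even_pancyclic
proof (rule ccontr)
  assume no: "\<not> ?thesis"
  obtain x2 x3 where L: "LX = {x1, x2, x3}" "x1 \<noteq> x2" "x1 \<noteq> x3" "x2 \<noteq> x3"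
  proof -
    have "card (LX - {x1}) = 2" using LX x by (simp add: card_Diff_singleton)
    then obtain x2 x3 where "LX - {x1} = {x2, x3}" "x2 \<noteq> x3" by (auto simp: card_2_iff)
    then show thesis using that[of x2 x3] x by blast
  qed
  have mem: "x2 \<in> X \<union> Y" "x3 \<in> X \<union> Y" "x2 \<in> LX" "x3 \<in> LX" using L low_sub by auto
  have out: "w \<in> LY" if "x \<in> {x2, x3}" "E x w" for x w
    using low_without_high_out[of x w] single that L by auto
  obtain w2 where w2: "E x2 w2" using out_exists[OF mem(1)] .
  obtain w3 where w3: "E x3 w3" using out_exists[OF mem(2)] .
  have "w2 \<noteq> w3" using low_X[OF mem(3,4)] w2 w3 L(4) by blast
  have "w2 \<in> LY" "w3 \<in> LY" using out w2 w3 by auto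
  moreover have fLY: "finite LY" using fin low_sub finite_subset by auto
  ultimately have LYe: "LY = {w2, w3}"
    using LY \<open>w2 \<noteq> w3\<close> card_seteq[of LY "{w2, w3}"] by auto
  have noz: "\<not> E w z" if "w \<in> LY" "z \<in> X - LX" for w z
    using three_low_via_low_Y[OF LX _ mem(3) x _ _ w2 _ that(2) y]
      three_low_via_low_Y[OF LX _ mem(4) x _ _ w3 _ that(2) y] LY L no that LYe by auto
  obtain p q where pq: "p \<in> {x2, x3} \<union> LY" "q \<notin> {x2, x3} \<union> LY" "E p q"
  proof -
    have "x1 \<notin> LY" using x low_mem disj by blast
    then show thesis using out_neighbour[of "{x2, x3} \<union> LY" x2 x1] L low_sub that by auto
  qed
  then have p: "p \<in> LY" using out by blast
  then have "q \<in> X" using arcD2 pq(3) low_mem by blast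
  then have q: "q = x1" using noz[OF p, of q] pq L by blast
  obtain x where xx: "x \<in> {x2, x3}" "E x p" using p LYe w2 w3 by auto
  obtain y where y': "y \<in> Y - LY" "y \<noteq> y1" using another_high[OF y(1)] .
  obtain z where z: "z \<in> X - LX" using some_high by blast
  have xm: "x \<in> LX" "x \<noteq> x1" using xx L by auto
  have "cyc E [x, p, x1, y1, z, y]"
    using xx(2) pq(3) q y y' z x xm p three_low[OF LX] low_mem side_distinct by (auto simp: cyc_def)
  then have "good [x, p, x1, y1, z, y]"
    by (rule goodI[of _ "{x, x1}" "{p}"]) (use xm x p LX LY in auto)
  then show False using even_pancyclic_six no by blast
qed

text \<open>Excluding the short configurations through low vertices of \<open>Y\<close> ties each of
  \<open>w1\<close>, \<open>w2\<close> by a 2-cycle to a private high vertex. These two turn out to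
  be all high vertices of \<open>X\<close>, which forces \<open>a = 5\<close> and then determines
  every arc.\<close>

lemma three_two_two_entries:
  assumes LX: "card LX = 3" and LY: "card LY = 2"
    and x: "x1 \<in> LX" "x2 \<in> LX" "x1 \<noteq> x2" and y: "y1 \<in> Y - LY" "E x1 y1" "y2 \<in> Y - LY" "E x2 y2"
    and no: "\<not> even_pancyclic"
  shows ten_vertex_exception
proof -
  have LY': "card LY \<le> 2" using LY by simp
  have fLY: "finite LY" using fin low_sub finite_subset by auto
  obtain w1 w2 where w: "LY = {w1, w2}" "w1 \<noteq> w2" using LY by (auto simp: card_2_iff)
  have wL: "w1 \<in> LY" "w2 \<in> LY" "w1 \<in> Y" "w2 \<in> Y" using w low_mem by auto
  note D' = dominating_bipartite.one_defect[OF swap w]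
  have no_into_low: "\<not> E w z" if "x \<in> LX" "w \<in> LY" "z \<in> X - LX" "E x w" for x w z
  proof
    assume wz: "E w z"
    show False
    proof (cases "x = x1")
      case True
      then show ?thesis using three_low_via_low_Y[OF LX LY' x that(2) _ wz that(3) y(3,4)] that no by auto
    next
      case False
      then show ?thesis
        using three_low_via_low_Y[OF LX LY' that(1) x(1) False that(2,4) wz that(3) y(1,2)] no by auto
    qed
  qed
  have no_from_low: False if "x \<in> LX" "w \<in> LY" "z \<in> X - LX" "E z w" "E w x" "y \<in> Y - LY" "E x y" for x w z y
  proof (cases "x = x1")
    case True
    then show ?thesis
      using three_low_from_low_Y[OF LX LY' x that(2,4,3) _ y] that no by auto
  next
    case False
    then show ?thesis
      using three_low_from_low_Y[OF LX LY' that(1) x(1) False that(2,4,3,5,6,7) y(1,2)] no by auto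
  qed
  have same: "z = z'" if "w \<in> LY" "z \<in> X - LX" "z' \<in> X - LX" "E z' w" "E w z" for w z z'
    using three_low_between_high[OF LX LY' x that(1,4,3,5,2) _ y] no by blast
  \<comment> \<open>Strong connectivity provides some in-neighbour of \<open>w\<close>, and
    \<open>no_into_low\<close> rules out a low one.\<close>
  have in_if_out: "\<exists>z' \<in> X - LX. E z' w" if wz: "w \<in> LY" "z \<in> X - LX" "E w z" for w z
  proof (rule ccontr)
    assume n: "\<not> ?thesis"
    have "w \<in> X \<union> Y" "z \<in> X \<union> Y" "z \<noteq> w" using wz low_mem side_distinct by auto
    then obtain p q where "p \<in> (X \<union> Y) - {w}" "q \<notin> (X \<union> Y) - {w}" "E p q"
      using out_neighbour[of "X \<union> Y - {w}" z w] by blast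
    then have "E p w" using arcs by blast
    then have "p \<in> LX" using n arcD4[of p w] wz low_mem by blast
    then show False using no_into_low[OF _ wz(1,2) \<open>E p w\<close>] wz(3) by blast
  qed
  \<comment> \<open>If \<open>w\<close> had no high out-neighbour, every high \<open>z\<close> not
    dominated by \<open>w'\<close> would have spent its misses and dominate all of \<open>Y\<close>.
    When \<open>w'\<close> has a high out-neighbour, some other high vertex contradicts
    \<open>same\<close>. Otherwise out-neighbours of \<open>w\<close> and \<open>w'\<close> are two
    low vertices besides \<open>x1\<close> and \<open>x2\<close>, one too many.\<close>
  have out_ex: "\<exists>z \<in> X - LX. E w z" if ww: "w \<in> LY" "w' \<in> LY" "w \<noteq> w'" for w w'
  proof (rule ccontr)
    assume n: "\<not> ?thesis"
    have LYe: "LY = {w, w'}" using w ww by auto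
    have D: "E z u \<or> E w' z" if "z \<in> X - LX" "u \<in> Y" for z u
      using D'(4)[OF that] n that(1) w LYe by auto
    show False
    proof (cases "\<exists>z \<in> X - LX. E w' z")
      case True
      then obtain z where z: "z \<in> X - LX" "E w' z" by blast
      obtain z0 where "z0 \<in> X - LX" "E z0 w'" using in_if_out[OF ww(2) z] by blast
      obtain z' where z': "z' \<in> X - LX" "z' \<noteq> z"
        using dominating_bipartite.another_high[OF swap z(1)] .
      have "\<not> E w' z'" "\<not> E z' w'"
        using same[OF ww(2) z'(1) \<open>z0 \<in> X - LX\<close> \<open>E z0 w'\<close>] same[OF ww(2) z(1) \<open>z0 \<in> X - LX\<close> \<open>E z0 w'\<close> z(2)]
          same[OF ww(2) z(1) z'(1) _ z(2)] z'(2) by auto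
      then show False using D[OF z'(1), of w'] ww low_mem by auto
    next
      case False
      obtain z where z: "z \<in> X - LX" using some_high by blast
      have zw: "E z w" "E z w'" using D[OF z] False z ww low_mem by auto
      obtain u where u: "E w u" using out_exists ww low_mem by (metis UnI2)
      obtain u' where u': "E w' u'" using out_exists ww low_mem by (metis UnI2)
      have "u \<noteq> u'" using low_Y ww u u' by blast
      have uX: "u \<in> LX" "u' \<in> LX" using u u' n False ww low_mem arcD2 by blast+
      have "u \<notin> {x1, x2}" "u' \<notin> {x1, x2}"
        using no_from_low[OF uX(1) ww(1) z zw(1) u] no_from_low[OF uX(2) ww(2) z zw(2) u'] y by auto
      then have "card {x1, x2, u, u'} = 4" using \<open>u \<noteq> u'\<close> x(3) by auto
      moreover have "card {x1, x2, u, u'} \<le> card LX"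
        using x uX fin low_sub finite_subset by (intro card_mono) auto
      ultimately show False using LX by simp
    qed
  qed
  obtain z1 where z1: "z1 \<in> X - LX" "E w1 z1" using out_ex[OF wL(1,2) w(2)] by blast
  obtain z2 where z2: "z2 \<in> X - LX" "E w2 z2" using out_ex[OF wL(2,1)] w(2) by blast
  have "z1 \<noteq> z2" using low_Y[OF wL(1,2)] z1 z2 w(2) by blast
  have in1: "E z w1 \<longleftrightarrow> z = z1" if "z \<in> X - LX" for z
    using in_if_out[OF wL(1) z1] same[OF wL(1) z1(1) _ _ z1(2)] that by blast
  have in2: "E z w2 \<longleftrightarrow> z = z2" if "z \<in> X - LX" for z
    using in_if_out[OF wL(2) z2] same[OF wL(2) z2(1) _ _ z2(2)] that by blast
  have out1: "E w1 z \<longleftrightarrow> z = z1" if "z \<in> X - LX" for z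
    using same[OF wL(1) that z1(1)] in1[OF z1(1)] z1 by blast
  have out2: "E w2 z \<longleftrightarrow> z = z2" if "z \<in> X - LX" for z
    using same[OF wL(2) that z2(1)] in2[OF z2(1)] z2 by blast
  \<comment> \<open>Every high vertex of \<open>X\<close> dominates \<open>w1\<close> or
    \<open>w2\<close>, but each of these has only one high in-neighbour.\<close>
  have HX: "X - LX = {z1, z2}"
  proof
    show "X - LX \<subseteq> {z1, z2}"
    proof
      fix z assume z: "z \<in> X - LX"
      then show "z \<in> {z1, z2}" using D'(1)[OF z wL(3,4) w(2)] in1 in2 by auto
    qed
  qed (use z1 z2 in auto)
  have fLX: "finite LX" using fin low_sub finite_subset by auto
  have "card (X - LX) = a - 3" using LX card_X low_sub fLX by (simp add: card_Diff_subset)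
  then have "a = 5" using HX \<open>z1 \<noteq> z2\<close> a by simp
  then have k: "card (Y - LY) = 3" using LY card_Y low_sub fLY by (simp add: card_Diff_subset)
  have xw: "\<not> E x w" if "x \<in> LX" "w \<in> LY" for x w
    using no_into_low[OF that(1) wL(1) z1(1)] no_into_low[OF that(1) wL(2) z2(1)] z1 z2 that w by auto
  have entry: "\<exists>y \<in> Y - LY. E x y" if "x \<in> LX" for x
  proof -
    have "x \<in> X \<union> Y" using that low_mem by blast
    then obtain v where "E x v" using out_exists by blast
    then show ?thesis using xw that arcD1 low_mem by blast
  qed
  have wx: "\<not> E w x" if "x \<in> LX" "w \<in> LY" for x w
    using no_from_low[OF that(1) wL(1) z1(1)] no_from_low[OF that(1) wL(2) z2(1)]
      in1[OF z1(1)] in2[OF z2(1)] entry that w by blast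
  obtain x3 where x3: "LX = {x1, x2, x3}" "x1 \<noteq> x3" "x2 \<noteq> x3"
  proof -
    have "card (LX - {x1, x2}) = 1" using LX x fLX by (simp add: card_Diff_subset)
    then obtain x3 where "LX - {x1, x2} = {x3}" by (auto simp: card_1_singleton_iff)
    then show thesis using that[of x3] x by blast
  qed
  obtain y3 where y3: "y3 \<in> Y - LY" "E x3 y3" using entry[of x3] x3 by blast
  have y123: "y1 \<noteq> y2" "y1 \<noteq> y3" "y2 \<noteq> y3"
    using low_X[of x1 x2 y1] low_X[of x1 x3 y1] low_X[of x2 x3 y2] x3 x y y3 by auto
  have HY: "Y - LY = {y1, y2, y3}"
    using card_seteq[of "Y - LY" "{y1, y2, y3}"] k y y3 y123 fin by auto
  have Xe: "X = {z1, z2, x1, x2, x3}" and Ye: "Y = {y1, y2, y3, w1, w2}"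
    using HX HY x3 w low_sub by auto
  have ex: "E xi y \<longleftrightarrow> y = yi" if "xi \<in> LX" "E xi yi" "y \<in> Y - LY" "(xi, yi) \<in> {(x1, y1), (x2, y2), (x3, y3)}" for xi yi y
    using low_X[OF x(1,2), of y] low_X[of x1 x3 y] low_X[of x2 x3 y] x x3 y y3 HY that by auto
  have E1: "E x1 y \<longleftrightarrow> y = y1" "E x2 y \<longleftrightarrow> y = y2" "E x3 y \<longleftrightarrow> y = y3" if "y \<in> Y - LY" for y
    using ex[of x1 y1 y] ex[of x2 y2 y] ex[of x3 y3 y] that x x3 y y3 by auto
  have dist: "distinct [w1, y1, y2, y3, w2, z1, z2, x1, x2, x3]"
    using y123 \<open>z1 \<noteq> z2\<close> x3 x(3) w(2) HX HY Xe Ye disj wL low_mem z1(1) z2(1) y y3 by auto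
  have hi: "y1 \<in> Y - LY" "y2 \<in> Y - LY" "y3 \<in> Y - LY" "z1 \<in> X - LX" "z2 \<in> X - LX"
    and lo: "x1 \<in> LX" "x2 \<in> LX" "x3 \<in> LX" using y y3 z1 z2 x3 by auto
  note T = three_low[OF LX]
  have arcE: "E u v \<longleftrightarrow> (u, v) \<in> {y1, y2, y3} \<times> {z1, z2, x1, x2, x3} \<union> {z1, z2} \<times> {y1, y2, y3} \<union>
      {(x1, y1), (x2, y2), (x3, y3), (w1, z1), (z1, w1), (w2, z2), (z2, w2)}" (is "_ \<longleftrightarrow> (u, v) \<in> ?R") for u v
  proof
    assume uv: "E u v"
    then consider "u \<in> X" "v \<in> Y" | "u \<in> Y" "v \<in> X" using arcs by blast
    then show "(u, v) \<in> ?R"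
    proof cases
      case 1
      show ?thesis
      proof (cases "u \<in> LX")
        case True
        then have "v \<in> Y - LY" using xw uv 1 by blast
        then have "(u, v) \<in> {(x1, y1), (x2, y2), (x3, y3)}" using True E1[of v] uv x3(1) by auto
        then show ?thesis by blast
      next
        case False
        then have u: "u \<in> {z1, z2}" "u \<in> X - LX" using 1 HX by auto
        show ?thesis
        proof (cases "v \<in> LY")
          case True
          then have "(u, v) \<in> {(z1, w1), (z2, w2)}" using in1[OF u(2)] in2[OF u(2)] uv w(1) by auto
          then show ?thesis by blast
        next
          case False
          then have "v \<in> {y1, y2, y3}" using 1 HY by blast
          then show ?thesis using u(1) by blast
        qed
      qed
    next
      case 2
      show ?thesis
      proof (cases "u \<in> LY")
        case True
        then have v: "v \<in> X - LX" using wx uv 2 by blast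
        then have "(u, v) \<in> {(w1, z1), (w2, z2)}" using out1[OF v] out2[OF v] uv True w(1) by auto
        then show ?thesis by blast
      next
        case False
        then have "u \<in> {y1, y2, y3}" using 2 HY by blast
        moreover have "v \<in> {z1, z2, x1, x2, x3}" using 2 Xe by blast
        ultimately show ?thesis by blast
      qed
    qed
  next
    assume "(u, v) \<in> ?R"
    then consider "(u, v) \<in> {y1, y2, y3} \<times> {z1, z2, x1, x2, x3}" | "(u, v) \<in> {z1, z2} \<times> {y1, y2, y3}"
      | "(u, v) \<in> {(x1, y1), (x2, y2), (x3, y3), (w1, z1), (z1, w1), (w2, z2), (z2, w2)}"
      by (elim UnE)
    then show "E u v"
    proof cases
      case 1
      then have "u \<in> Y - LY" "v \<in> X" unfolding HY Xe by (simp_all only: mem_Sigma_iff)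
      then show ?thesis by (rule T(1))
    next
      case 2
      then have "v \<in> Y - LY" "u \<in> X - LX" unfolding HY HX by (simp_all only: mem_Sigma_iff)
      then show ?thesis by (rule T(2))
    next
      case 3
      have "E z1 w1" "E z2 w2" using in1[OF hi(4)] in2[OF hi(5)] by simp_all
      then show ?thesis using 3 y y3 z1(2) z2(2) by auto
    qed
  qed
  \<comment> \<open>The partite sets change roles: high vertices of \<open>Y\<close> become
    \<open>x1\<close>, \<open>x2\<close>, \<open>x3\<close> of \<open>D(10)\<close> and the low ones
    \<open>x0\<close>, \<open>x4\<close>; \<open>z1\<close>, \<open>z2\<close> become
    \<open>y0\<close>, \<open>y1\<close>, and the low vertices of \<open>X\<close> become
    \<open>y2\<close>, \<open>y3\<close>, \<open>y4\<close>.\<close>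
  have "distinct [w1, y1, y2, y3, w2, z1, z2, x1, x2, x3] \<and>
    X \<union> Y = {w1, y1, y2, y3, w2, z1, z2, x1, x2, x3} \<and>
    (\<forall>u v. E u v \<longleftrightarrow> (u, v) \<in> {y1, y2, y3} \<times> {z1, z2, x1, x2, x3} \<union> {z1, z2} \<times> {y1, y2, y3} \<union>
      {(x1, y1), (x2, y2), (x3, y3), (w1, z1), (z1, w1), (w2, z2), (z2, w2)})"
  proof (intro conjI allI)
    show "X \<union> Y = {w1, y1, y2, y3, w2, z1, z2, x1, x2, x3}" unfolding Xe Ye by blast
  qed (fact dist, fact arcE)
  then show ?thesis
    unfolding ten_vertex_exception_def by (intro exI)
qed

lemma three_two:
  assumes LX: "card LX = 3" and LY: "card LY = 2"
  shows "even_pancyclic \<or> ten_vertex_exception"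
proof -
  obtain y where "y \<in> Y - LY" using dominating_bipartite.some_high[OF swap] by blast
  moreover obtain x where "x \<in> LX" "E x y" using three_low(3)[OF LX] calculation by blast
  ultimately show ?thesis
    using three_two_one_entry[OF assms, of x y] three_two_two_entries[OF assms, of x _ y] by blast
qed


section \<open>Three low vertices on both sides\<close>

lemma three_three_configuration:
  assumes LX: "card LX = 3" and LY: "card LY = 3"
    and x: "x1 \<in> LX" "x2 \<in> LX" "x1 \<noteq> x2" "y1 \<in> Y - LY" "E x1 y1"
    and u: "u2 \<in> LY" "E x2 u2" "E u2 z" "z \<in> X - LX" "y \<in> Y - LY" "y \<noteq> y1"
    and v: "x3 \<in> LX" "x3 \<noteq> x1" "x3 \<noteq> x2" "u3 \<in> LY" "E x3 u3" "E u3 x1 \<or> (\<exists>z' \<in> X - LX. E u3 z')"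
  shows even_pancyclic
proof -
  note T = three_low[OF LX]
  have "u2 \<noteq> u3" using low_X[of x2 x3 u2] x u v by auto
  obtain z0 where z0: "z0 \<in> X - LX" "z0 \<noteq> z"
    using dominating_bipartite.another_high[OF swap u(4)] .
  have six: "cyc E [x2, u2, z, y, x1, y1]"
    using x u T low_mem side_distinct by (auto simp: cyc_def)
  have avoid: "z0 \<notin> {x2, u2, z, y, x1, y1}"
    using z0 x u low_mem side_distinct[of z0] by auto
  \<comment> \<open>Two low vertices per side must be covered, but the 6-cycle contains only one of
    \<open>Y\<close>. The 8-cycles below add \<open>x3\<close> and \<open>u3\<close>; the 6-cycle
    omitting \<open>z0\<close> serves the case \<open>a = 5\<close>.\<close>
  have A: "{x2, x3} \<subseteq> LX" "card LX \<le> Suc (card {x2, x3})" "{u2, u3} \<subseteq> LY" "card LY \<le> Suc (card {u2, u3})"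
    using x u v LX LY \<open>u2 \<noteq> u3\<close> by auto
  show ?thesis
  proof (cases "E u3 x1")
    case True
    have "cyc E [x3, u3, x1, y1, x2, u2, z, y]"
      using True x u v \<open>u2 \<noteq> u3\<close> T low_mem side_distinct by (auto simp: cyc_def)
    then have "good [x3, u3, x1, y1, x2, u2, z, y]"
      by (rule goodI[OF _ A(1) _ A(2,3) _ A(4)]) auto
    then show ?thesis using eight_six[OF _ six _ avoid] z0 by blast
  next
    case False
    then obtain z' where z': "z' \<in> X - LX" "E u3 z'" using v by blast
    have "z' \<noteq> z" using low_Y[of u2 u3 z] u v z' \<open>u2 \<noteq> u3\<close> by auto
    then have "cyc E [x2, u2, z, y, x3, u3, z', y1]"
      using z' x u v \<open>u2 \<noteq> u3\<close> T low_mem side_distinct by (auto simp: cyc_def)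
    then have "good [x2, u2, z, y, x3, u3, z', y1]"
      by (rule goodI[OF _ A(1) _ A(2,3) _ A(4)]) auto
    then show ?thesis using eight_six[OF _ six _ avoid] z0 by blast
  qed
qed

lemma three_three_chain:
  assumes LX: "card LX = 3" and LY: "card LY = 3"
    and x: "x2 \<in> LX" "x3 \<in> LX" "x2 \<noteq> x3"
    and u: "u2 \<in> LY" "u3 \<in> LY" "E x3 u3" "E u3 x2" "E x2 u2" "E u2 p" "p \<in> X" "p \<noteq> x2" "p \<noteq> x3"
    and y: "y \<in> Y - LY" "E p y"
  shows even_pancyclic
proof -
  have "u2 \<noteq> u3" using low_X[of x2 x3 u2] x u by auto
  then have "cyc E [x3, u3, x2, u2, p, y]"
    using x u y three_low[OF LX] low_mem side_distinct by (auto simp: cyc_def)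
  then have "good [x3, u3, x2, u2, p, y]"
    by (rule goodI[of _ "{x2, x3}" "{u2, u3}"]) (use x u LX LY \<open>u2 \<noteq> u3\<close> in auto)
  then show ?thesis by (rule even_pancyclic_six)
qed

text \<open>\<open>x2\<close> and \<open>x3\<close> continue only to low vertices. Strong
  connectivity lets one of them leave \<open>{x2, x3}\<close> within two arcs; two arcs from the
  other one then end elsewhere, because low vertices of \<open>Y\<close> share no
  out-neighbour.\<close>

lemma three_three_one_entry:
  assumes LX: "card LX = 3" and LY: "card LY = 3"
    and x: "x1 \<in> LX" and y: "y1 \<in> Y - LY" "E x1 y1"
    and single: "\<And>x y. x \<in> LX \<Longrightarrow> x \<noteq> x1 \<Longrightarrow> y \<in> Y - LY \<Longrightarrow> \<not> E x y"
  shows even_pancyclic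
proof -
  have two: "even_pancyclic"
    if L: "x2 \<in> LX" "x3 \<in> LX" "x1 \<noteq> x2" "x1 \<noteq> x3" "x2 \<noteq> x3"
      and u: "E x2 u2" "E u2 p2" "p2 \<in> X" "p2 \<noteq> x2" "p2 \<noteq> x3" "LX = {x1, x2, x3}" for x2 x3 u2 p2
  proof -
    have out: "w \<in> LY" if "x \<in> {x2, x3}" "E x w" for x w
      using low_without_high_out[of x w] single that L by auto
    have "x3 \<in> X \<union> Y" using L low_mem by blast
    then obtain u3' where u3': "E x3 u3'" using out_exists by blast
    have "x2 \<notin> insert x3 {w. E x3 w}"
      using L out[of x3 x2] low_mem side_distinct[of x2 x2] by auto
    moreover have "insert x3 {w. E x3 w} \<subseteq> X \<union> Y" using arcs low_mem L by blast
    ultimately obtain q p3 where q: "q \<in> insert x3 {w. E x3 w}" "p3 \<notin> insert x3 {w. E x3 w}" "E q p3"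
      using out_neighbour[of "insert x3 {w. E x3 w}" x3 x2] L(1) low_mem by blast
    then have q3: "E x3 q" "p3 \<noteq> x3" by auto
    have uL: "u2 \<in> LY" "q \<in> LY" using out u(1) q3 by auto
    have "u2 \<noteq> q" using low_X[of x2 x3 q] L u(1) q3 by auto
    then have "p2 \<noteq> p3" using low_Y[OF uL u(2)] q(3) by blast
    have "p3 \<in> X" using q(3) uL arcD2 low_mem by blast
    obtain y' where y': "y' \<in> Y - LY" "y' \<noteq> y1" using another_high[OF y(1)] .
    have p: "p2 \<in> X - LX \<or> p2 = x1" "p3 \<in> X - LX \<or> p3 = x1 \<or> p3 = x2"
      using u \<open>p3 \<in> X\<close> q3 by auto
    consider "p3 = x2" | "p2 \<in> X - LX" "p3 \<noteq> x2" | "p2 = x1" "p3 \<in> X - LX"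
      using p \<open>p2 \<noteq> p3\<close> by blast
    then show ?thesis
    proof cases
      case 1
      obtain y0 where "y0 \<in> Y - LY" "E p2 y0"
        using p(1) y dominating_bipartite.three_low(1)[OF swap LY, of p2 y1] by auto
      then show ?thesis
        using three_three_chain[OF LX LY L(1,2,5) uL q3(1) _ u(1,2,3,4,5)] q(3) 1 by blast
    next
      case 2
      then show ?thesis
        using three_three_configuration[OF LX LY x L(1,3) y uL(1) u(1,2) 2(1) y' L(2) _ _ uL(2) q3(1)]
          L p(2) q(3) by blast
    next
      case 3
      then show ?thesis
        using three_three_configuration[OF LX LY x L(2,4) y uL(2) q3(1) q(3) 3(2) y' L(1) _ L(5) uL(1) u(1)]
          L u(2) by blast
    qed
  qed
  obtain x2 x3 where L: "LX = {x1, x2, x3}" "x1 \<noteq> x2" "x1 \<noteq> x3" "x2 \<noteq> x3"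
  proof -
    have "card (LX - {x1}) = 2" using LX x by (simp add: card_Diff_singleton)
    then obtain x2 x3 where "LX - {x1} = {x2, x3}" "x2 \<noteq> x3" by (auto simp: card_2_iff)
    then show thesis using that[of x2 x3] x by blast
  qed
  have mem: "x2 \<in> LX" "x3 \<in> LX" using L by auto
  have out: "w \<in> LY" if "x \<in> {x2, x3}" "E x w" for x w
    using low_without_high_out[of x w] single that L by auto
  define S where "S = {x2, x3} \<union> {w. E x2 w} \<union> {w. E x3 w}"
  have "S \<subseteq> X \<union> Y" using arcs mem low_mem unfolding S_def by blast
  moreover have "x1 \<notin> S"
    using L x out[of _ x1] low_mem side_distinct[of x1 x1] unfolding S_def by auto
  moreover have "x2 \<in> S" "x1 \<in> X \<union> Y" using x low_mem by (auto simp: S_def)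
  ultimately obtain u p where up: "u \<in> S" "p \<notin> S" "E u p"
    using out_neighbour[of S x2 x1] by blast
  then have u: "E x2 u \<or> E x3 u" unfolding S_def by blast
  then have "p \<in> X" using out up(3) low_mem arcD2 by blast
  moreover have "p \<noteq> x2" "p \<noteq> x3" using up(2) by (auto simp: S_def)
  moreover have "LX = {x1, x3, x2}" using L by auto
  ultimately show ?thesis
    using two[of x2 x3 u p] two[of x3 x2 u p] u up(3) L mem by blast
qed

text \<open>High vertices of either side now dominate the whole other side, so a single arc from a
  further low \<open>x3\<close> to \<open>w1\<close> suffices for an 8-cycle. Skipping
  \<open>w2\<close> and \<open>z2\<close> shortens it to a 6-cycle that omits
  \<open>z2\<close>.\<close>

lemma three_three_detour:
  assumes LX: "card LX = 3" and LY: "card LY = 3"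
    and x: "x2 \<in> LX" "y2 \<in> Y - LY" "E x2 y2" "y1 \<in> Y - LY" "y1 \<noteq> y2"
    and w: "w1 \<in> LY" "w2 \<in> LY" "w1 \<noteq> w2" "z1 \<in> X - LX" "z2 \<in> X - LX" "E w1 z1" "E w2 z2"
    and x3: "x3 \<in> LX" "x3 \<noteq> x2" "E x3 w1"
  shows even_pancyclic
proof -
  note T = three_low[OF LX] and T' = dominating_bipartite.three_low[OF swap LY]
  have "z1 \<noteq> z2" using low_Y[of w1 w2 z1] w by auto
  then have "cyc E [x3, w1, z1, w2, z2, y1, x2, y2]"
    using x w x3 T T'(1) low_mem side_distinct by (auto simp: cyc_def)
  then have "good [x3, w1, z1, w2, z2, y1, x2, y2]"
    by (rule goodI[of _ "{x2, x3}" "{w1, w2}"]) (use x w x3 LX LY in auto)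
  moreover have "cyc E [x3, w1, z1, y1, x2, y2]"
    using x w x3 T T'(1) low_mem side_distinct by (auto simp: cyc_def)
  moreover have "z2 \<notin> {x3, w1, z1, y1, x2, y2}"
    using \<open>z1 \<noteq> z2\<close> x w x3 low_mem side_distinct[of z2] by auto
  ultimately show ?thesis using eight_six w(5) by blast
qed

text \<open>Third high vertices on both sides link the given arcs to a 10-cycle. For
  \<open>a = 6\<close> its length is already \<open>2 * a - 2\<close>, so the 8-cycle omitting
  \<open>z2\<close> is supplied for the shorter lengths.\<close>

lemma three_three_large:
  assumes LX: "card LX = 3" and LY: "card LY = 3" and a6: "a \<noteq> 5"
    and x: "x1 \<in> LX" "x2 \<in> LX" "x1 \<noteq> x2" "y1 \<in> Y - LY" "E x1 y1" "y2 \<in> Y - LY" "E x2 y2"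
    and w: "w1 \<in> LY" "w2 \<in> LY" "w1 \<noteq> w2" "z1 \<in> X - LX" "E w1 z1" "z2 \<in> X - LX" "E w2 z2"
  shows even_pancyclic
proof -
  have fL: "finite LX" "finite LY" using fin low_sub finite_subset by auto
  have k: "3 \<le> card (X - LX)" "3 \<le> card (Y - LY)"
    using LX LY a a6 card_X card_Y low_sub fL by (simp_all add: card_Diff_subset)
  have ne: "y1 \<noteq> y2" "z1 \<noteq> z2" using low_X[of x1 x2 y1] low_Y[of w1 w2 z1] x w by auto
  obtain y3 where y3: "y3 \<in> Y - LY" "y3 \<noteq> y1" "y3 \<noteq> y2" using third_high[OF k(2)] .
  obtain z3 where z3: "z3 \<in> X - LX" "z3 \<noteq> z1" "z3 \<noteq> z2"
    using dominating_bipartite.third_high[OF swap k(1)] .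
  note T = three_low[OF LX] and T' = dominating_bipartite.three_low[OF swap LY]
  have ten: "cyc E [x1, y1, x2, y2, z3, w1, z1, w2, z2, y3]"
    using x w y3 z3 ne T T'(1) low_mem side_distinct by (auto simp: cyc_def)
  then have g: "good [x1, y1, x2, y2, z3, w1, z1, w2, z2, y3]"
    by (rule goodI[of _ "{x1, x2}" "{w1, w2}"]) (use x w LX LY in auto)
  have eight: "cyc E [x1, y1, x2, y2, z3, w1, z1, y3]"
    using x w y3 z3 ne T T'(1) low_mem side_distinct by (auto simp: cyc_def)
  have "z2 \<notin> {x1, y1, x2, y2, z3, w1, z1, y3}"
    using x w y3 z3 ne low_mem side_distinct[of z2] by auto
  then show ?thesis
    using even_pancyclicI[OF ten _ eight, of z2] even_pancyclic_if_good[OF g, of 5] w(6) a a6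
    by (cases "a = 6") auto
qed

text \<open>For \<open>a = 5\<close> the two high vertices of each side are dominated by
  \<open>x1\<close>, \<open>x2\<close> and by \<open>w1\<close>, \<open>w2\<close>, so
  \<open>x3\<close> and \<open>w3\<close> have low out-neighbours only. The detours exclude all of
  these except \<open>x3\<close> and \<open>w3\<close> themselves, and no arc would leave
  \<open>{x3, w3}\<close>.\<close>

lemma three_three_two_entries:
  assumes LX: "card LX = 3" and LY: "card LY = 3"
    and x: "x1 \<in> LX" "x2 \<in> LX" "x1 \<noteq> x2" "y1 \<in> Y - LY" "E x1 y1" "y2 \<in> Y - LY" "E x2 y2"
    and w: "w1 \<in> LY" "w2 \<in> LY" "w1 \<noteq> w2" "z1 \<in> X - LX" "E w1 z1" "z2 \<in> X - LX" "E w2 z2"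
  shows even_pancyclic
proof (cases "a = 5")
  case False
  then show ?thesis using three_three_large[OF LX LY _ x w] by blast
next
  case True
  have fL: "finite LX" "finite LY" using fin low_sub finite_subset by auto
  have k: "card (X - LX) = 2" "card (Y - LY) = 2"
    using True LX LY card_X card_Y low_sub fL by (simp_all add: card_Diff_subset)
  have ne: "y1 \<noteq> y2" "z1 \<noteq> z2" using low_X[of x1 x2 y1] low_Y[of w1 w2 z1] x w by auto
  have HY: "Y - LY = {y1, y2}" using card_seteq[of "Y - LY" "{y1, y2}"] k x ne fin by auto
  have HX: "X - LX = {z1, z2}" using card_seteq[of "X - LX" "{z1, z2}"] k w ne fin by auto
  have "card (LX - {x1, x2}) = 1" "card (LY - {w1, w2}) = 1"
    using LX LY x w fL by (simp_all add: card_Diff_subset)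
  then obtain x3 w3 where "LX - {x1, x2} = {x3}" "LY - {w1, w2} = {w3}"
    by (auto simp: card_1_singleton_iff)
  then have x3: "LX = {x1, x2, x3}" "x3 \<noteq> x1" "x3 \<noteq> x2" "x3 \<in> LX"
    and w3: "LY = {w1, w2, w3}" "w3 \<noteq> w1" "w3 \<noteq> w2" "w3 \<in> LY" using x w by auto
  have nx: "\<not> E x3 y" if "y \<in> Y - LY" for y
    using low_X[OF x(1) x3(4), of y] low_X[OF x(2) x3(4), of y] x x3 that HY by auto
  have nw: "\<not> E w3 z" if "z \<in> X - LX" for z
    using low_Y[OF w(1) w3(4), of z] low_Y[OF w(2) w3(4), of z] w w3 that HX by auto
  note D = three_three_detour[OF LX LY] and D' = dominating_bipartite.three_three_detour[OF swap LY LX]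
  show ?thesis
  proof (rule ccontr)
    assume no: "\<not> ?thesis"
    have x3w: "\<not> E x3 w1" "\<not> E x3 w2"
      using D[OF x(2,6,7,4) ne(1) w(1,2,3,4,6,5,7) x3(4,3)]
        D[OF x(2,6,7,4) ne(1) w(2,1) w(3)[symmetric] w(6,4,7,5) x3(4,3)] no by auto
    have w3x: "\<not> E w3 x1" "\<not> E w3 x2"
      using D'[OF w(2,6,7,4) ne(2) x(1,2,3,4,6,5,7) w3(4,3)]
        D'[OF w(2,6,7,4) ne(2) x(2,1) x(3)[symmetric] x(6,4,7,5) w3(4,3)] no swap_even_pancyclic by auto
    have mem: "x3 \<in> X" "w3 \<in> Y" "x1 \<in> X" using x x3 w3 low_mem by auto
    have "x1 \<notin> {x3, w3}" using x3 mem side_distinct[of x1 w3] by auto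
    then obtain p q where pq: "p \<in> {x3, w3}" "q \<notin> {x3, w3}" "E p q"
      using out_neighbour[of "{x3, w3}" x3 x1] mem by blast
    then consider "p = x3" "q \<in> Y" | "p = w3" "q \<in> X" using arcD1 arcD2 mem by blast
    then show False
    proof cases
      case 1
      then have "q \<in> LY" using nx pq(3) by blast
      then show False using x3w pq 1(1) w3(1) by auto
    next
      case 2
      then have "q \<in> LX" using nw pq(3) by blast
      then show False using w3x pq 2(1) x3(1) by auto
    qed
  qed
qed

lemma even_pancyclic_three_three:
  assumes LX: "card LX = 3" and LY: "card LY = 3"
  shows even_pancyclic
proof -
  obtain y1 where y1: "y1 \<in> Y - LY" using dominating_bipartite.some_high[OF swap] by blast
  obtain x1 where x1: "x1 \<in> LX" "E x1 y1" using three_low(3)[OF LX y1] by blast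
  obtain z1 where z1: "z1 \<in> X - LX" using some_high by blast
  obtain w1 where w1: "w1 \<in> LY" "E w1 z1" using dominating_bipartite.three_low(3)[OF swap LY z1] by blast
  show ?thesis
  proof (rule ccontr)
    assume no: "\<not> ?thesis"
    obtain x2 y2 where "x2 \<in> LX" "x2 \<noteq> x1" "y2 \<in> Y - LY" "E x2 y2"
      using three_three_one_entry[OF LX LY x1(1) y1 x1(2)] no by blast
    moreover obtain w2 z2 where "w2 \<in> LY" "w2 \<noteq> w1" "z2 \<in> X - LX" "E w2 z2"
      using dominating_bipartite.three_three_one_entry[OF swap LY LX w1(1) z1 w1(2)] no swap_even_pancyclic
      by blast
    ultimately show False using three_three_two_entries[OF LX LY] x1 y1 w1 z1 no by metis
  qed
qed

lemma even_pancyclic_or_exception_aux: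
  assumes "card LY \<le> card LX"
  shows "even_pancyclic \<or> ten_vertex_exception"
proof -
  consider "card LX \<le> 1" "card LY \<le> 1" | "card LX = 2" "card LY \<le> 1" | "card LX = 2" "card LY = 2"
    | "card LX = 3" "card LY \<le> 1" | "card LX = 3" "card LY = 2" | "card LX = 3" "card LY = 3"
    using assms low_card by linarith
  then show ?thesis
    using even_pancyclic_few_low even_pancyclic_two_one even_pancyclic_two_two
      even_pancyclic_three_one three_two even_pancyclic_three_three by cases auto
qed

theorem even_pancyclic_or_exception: "even_pancyclic \<or> ten_vertex_exception"
proof (cases "card LY \<le> card LX")
  case True
  then show ?thesis by (rule even_pancyclic_or_exception_aux)
next
  case False
  have "dominating_bipartite.ten_vertex_exception E Y X \<longleftrightarrow> ten_vertex_exception"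
    unfolding ten_vertex_exception_def dominating_bipartite.ten_vertex_exception_def[OF swap]
    by (simp only: Un_commute)
  then show ?thesis
    using dominating_bipartite.even_pancyclic_or_exception_aux[OF swap] False swap_even_pancyclic by simp
qed

end

section \<open>Transfer to digraphs\<close>

lemma (in wf_digraph) awalk_of_successively:
  assumes "successively (\<lambda>u v. u \<rightarrow> v) (u # vs)" "u \<in> verts G"
  shows "\<exists>p. awalk u p (last (u # vs)) \<and> awalk_verts u p = u # vs"
  using assms
proof (induction vs arbitrary: u)
  case Nil
  then show ?case by (intro exI[of _ "[]"]) (simp add: awalk_Nil_iff)
next
  case (Cons v vs)
  then obtain e where e: "e \<in> arcs G" "tail G e = u" "head G e = v" by auto
  then obtain p where "awalk v p (last (v # vs))" "awalk_verts v p = v # vs"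
    using Cons by fastforce
  then show ?case using e by (intro exI[of _ "e # p"]) (simp add: awalk_Cons_iff)
qed

lemma (in wf_digraph) has_cycle_of_length_cyc:
  assumes "cyc (\<lambda>u v. u \<rightarrow> v) c"
  shows "has_cycle_of_length G (length c)"
proof -
  obtain u r where c: "c = u # r" using assms by (cases c) (auto simp: cyc_def)
  have s: "successively (\<lambda>u v. u \<rightarrow> v) (u # (r @ [u]))" and d: "distinct (r @ [u])"
    using assms by (auto simp: cyc_def c)
  have "u \<in> verts G" using s by (cases r) (auto simp: adj_in_verts)
  then obtain p where p: "awalk u p u" "awalk_verts u p = u # (r @ [u])"
    using awalk_of_successively[OF s] by auto
  have "length p = length c" using length_awalk_verts[of u p] p(2) c by simp
  moreover have "cycle p" unfolding cycle_def using p d \<open>length p = _\<close> c by (intro exI[of _ u]) auto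
  ultimately show ?thesis by (auto simp: has_cycle_of_length_def)
qed

lemma (in nomulti_digraph) degree_conv:
  "out_degree G v = card {w. v \<rightarrow> w}" "in_degree G v = card {w. w \<rightarrow> v}"
proof -
  have "bij_betw (head G) (out_arcs G v) {w. v \<rightarrow> w}"
    unfolding bij_betw_def
    by (auto simp: inj_on_def out_arcs_def arcs_ends_def arc_to_ends_def intro!: no_multi_arcs)
  then show "out_degree G v = card {w. v \<rightarrow> w}" by (simp add: out_degree_def bij_betw_same_card)
  have "bij_betw (tail G) (in_arcs G v) {w. w \<rightarrow> v}"
    unfolding bij_betw_def
    by (auto simp: inj_on_def in_arcs_def arcs_ends_def arc_to_ends_def intro!: no_multi_arcs)
  then show "in_degree G v = card {w. w \<rightarrow> v}" by (simp add: in_degree_def bij_betw_same_card)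
qed

section \<open>Isomorphism with the two concrete digraphs\<close>

lemma (in nomulti_digraph) digraph_iso_with_proj:
  assumes bij: "bij_betw \<psi> (pverts H) (verts G)" and sub: "parcs H \<subseteq> pverts H \<times> pverts H"
    and arcs: "arcs_ends G = map_prod \<psi> \<psi> ` parcs H"
  shows "digraph_iso G (with_proj H)"
proof -
  \<comment> \<open>\<open>\<psi>\<close> runs from the concrete digraph, where it can be written as
    an iteration or a table; the isomorphism runs the other way. Without multiple arcs the vertex
    map determines the arc map.\<close>
  define \<phi> where "\<phi> = inv_into (pverts H) \<psi>"
  have \<phi>: "\<phi> (\<psi> p) = p" if "p \<in> pverts H" for p
    using bij that by (simp add: \<phi>_def bij_betw_def)
  have b: "bij_betw \<phi> (verts G) (pverts H)" unfolding \<phi>_def by (rule bij_betw_inv_into[OF bij])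
  define hom where "hom = \<lparr>iso_verts = \<phi>, iso_arcs = \<lambda>e. (\<phi> (tail G e), \<phi> (head G e)),
    iso_head = snd, iso_tail = fst\<rparr>"
  have inj: "inj_on \<phi> (verts G)" using b by (simp add: bij_betw_def)
  have "digraph_isomorphism hom"
    unfolding digraph_isomorphism_def hom_def
    using wf_digraph_axioms inj
    by (auto simp: inj_on_def arc_to_ends_def intro!: no_multi_arcs)
  moreover have "with_proj H = app_iso hom G"
  proof -
    have "(\<lambda>e. (\<phi> (tail G e), \<phi> (head G e))) ` arcs G = map_prod \<phi> \<phi> ` arcs_ends G"
      by (auto simp: arcs_ends_def arc_to_ends_def image_image)
    also have "\<dots> = (\<lambda>p. p) ` parcs H"
      unfolding arcs image_image using sub \<phi> by (intro image_cong) auto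
    finally show ?thesis
      using b by (simp add: with_proj_def app_iso_def hom_def bij_betw_def)
  qed
  ultimately show ?thesis by (auto simp: digraph_iso_def)
qed

lemma (in digraph) reachable_closed:
  assumes "u \<rightarrow>\<^sup>* v" "u \<in> S" "\<And>p q. p \<in> S \<Longrightarrow> p \<rightarrow> q \<Longrightarrow> q \<in> S"
  shows "v \<in> S"
  using assms(1)
proof (induction rule: reachable_induct)
  case base
  show ?case by (rule assms(2))
next
  case (step p q)
  then show ?case using assms(3) by blast
qed

text \<open>Unique in-neighbours make a choice \<open>f\<close> of out-neighbours injective, hence a
  permutation of the finite vertex set that accounts for every arc. Strong connectivity makes it a
  single orbit.\<close>

lemma (in digraph) directed_cycle_if_in_unique:
  assumes sc: "strongly_connected G" and card: "card (verts G) = n" "2 \<le> n"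
    and unique: "\<And>u v w. u \<rightarrow> w \<Longrightarrow> v \<rightarrow> w \<Longrightarrow> u = v"
  shows "digraph_iso G (directed_cycle n)"
proof -
  have closed: "verts G \<subseteq> S" if "u \<in> S" "u \<in> verts G" "\<And>p q. p \<in> S \<Longrightarrow> p \<rightarrow> q \<Longrightarrow> q \<in> S" for S u
    using sc reachable_closed[OF _ that(1,3)] that(2) by (auto simp: strongly_connected_def)
  have "\<exists>v. u \<rightarrow> v" if "u \<in> verts G" for u
  proof (rule ccontr)
    assume "\<not> ?thesis"
    then have "verts G \<subseteq> {u}" using closed[of u "{u}"] that by auto
    then show False using card card_mono[of "{u}" "verts G"] by simp
  qed
  then obtain f where f: "\<And>u. u \<in> verts G \<Longrightarrow> u \<rightarrow> f u" by metis
  have fV: "f u \<in> verts G" if "u \<in> verts G" for u using f[OF that] by (rule adj_in_verts)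
  have inj: "inj_on f (verts G)" using unique f by (metis inj_onI)
  have surj: "f ` verts G = verts G" using endo_inj_surj[OF _ _ inj] fV by auto
  have arc: "u \<rightarrow> v \<longleftrightarrow> u \<in> verts G \<and> v = f u" for u v
  proof
    assume uv: "u \<rightarrow> v"
    then obtain u' where "u' \<in> verts G" "v = f u'" using surj adj_in_verts(2) by blast
    then show "u \<in> verts G \<and> v = f u" using unique[OF uv] f adj_in_verts(1)[OF uv] by blast
  qed (use f in auto)
  obtain v0 where v0: "v0 \<in> verts G" using sc by (auto simp: strongly_connected_def)
  define \<psi> where "\<psi> i = (f ^^ i) v0" for i
  have \<psi>V: "\<psi> i \<in> verts G" for i by (induction i) (auto simp: \<psi>_def v0 fV)
  have "\<not> inj_on \<psi> {..n}"
    using card_inj_on_le[of \<psi> "{..n}" "verts G"] \<psi>V card by auto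
  then obtain i j where ij: "i < j" "j \<le> n" "\<psi> i = \<psi> j"
    unfolding inj_on_def by (metis atMost_iff linorder_neqE_nat)
  \<comment> \<open>Cancelling the injective \<open>f\<close> moves a repetition in the orbit back
    to the starting vertex \<open>v0\<close>.\<close>
  have shift: "\<psi> i = \<psi> (i + m) \<Longrightarrow> \<psi> 0 = \<psi> m" for i m
  proof (induction i)
    case (Suc i)
    then have "f (\<psi> i) = f (\<psi> (i + m))" by (simp add: \<psi>_def)
    then show ?case using Suc.IH inj_onD[OF inj] \<psi>V by blast
  qed simp
  define m where "m = j - i"
  have m: "0 < m" "m \<le> n" "\<psi> m = \<psi> 0" using ij shift[of i m] by (auto simp: m_def)
  have "verts G \<subseteq> \<psi> ` {..<m}"
  proof (rule closed[of "\<psi> 0"])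
    fix p q assume "p \<in> \<psi> ` {..<m}" "p \<rightarrow> q"
    then obtain k where k: "k < m" "q = \<psi> (Suc k)" by (auto simp: arc \<psi>_def)
    then show "q \<in> \<psi> ` {..<m}" using m by (cases "Suc k = m") auto
  qed (use m \<psi>V in auto)
  then have img: "\<psi> ` {..<m} = verts G" using \<psi>V by auto
  then have "m = n" using card m(2) card_image_le[of "{..<m}" \<psi>] by simp
  have "inj_on \<psi> {..<n}" using img card \<open>m = n\<close> by (intro eq_card_imp_inj_on) auto
  then have bij: "bij_betw \<psi> {0..<n} (verts G)"
    using img \<open>m = n\<close> by (simp add: bij_betw_def atLeast0LessThan)
  have wrap: "\<psi> (Suc i mod n) = f (\<psi> i)" if "i < n" for i
    using that m(3) \<open>m = n\<close> by (cases "Suc i = n") (auto simp: \<psi>_def)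
  have "arcs_ends G = (\<lambda>i. (\<psi> i, f (\<psi> i))) ` {..<n}"
    using arc unfolding img[unfolded \<open>m = n\<close>, symmetric] by auto
  also have "\<dots> = map_prod \<psi> \<psi> ` (\<lambda>i. (i, Suc i mod n)) ` {..<n}"
    unfolding image_image using wrap by (intro image_cong) auto
  also have "(\<lambda>i. (i, Suc i mod n)) ` {..<n} = {(i, Suc i mod n) | i. i < n}" by auto
  finally show ?thesis
    unfolding directed_cycle_def using bij card(2)
    by (intro digraph_iso_with_proj[where \<psi> = \<psi>]) auto
qed

lemma (in digraph) digraph_iso_D10:
  assumes d: "distinct [x0, x1, x2, x3, x4, y0, y1, y2, y3, y4]"
    and V: "verts G = {x0, x1, x2, x3, x4, y0, y1, y2, y3, y4}"
    and E: "arcs_ends G = {x1, x2, x3} \<times> {y0, y1, y2, y3, y4} \<union> {y0, y1} \<times> {x1, x2, x3} \<union>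
      {(y2, x1), (y3, x2), (y4, x3), (x0, y0), (y0, x0), (x4, y1), (y1, x4)}"
  shows "digraph_iso G D10"
proof -
  define \<psi> where "\<psi> = case_sum (\<lambda>i. [x0, x1, x2, x3, x4] ! i) (\<lambda>j. [y0, y1, y2, y3, y4] ! j)"
  have n5: "{0..4} = {0, 1, 2, 3, 4 :: nat}" by auto
  have \<psi>: "\<psi> (Inl 0) = x0" "\<psi> (Inl 1) = x1" "\<psi> (Inl 2) = x2" "\<psi> (Inl 3) = x3" "\<psi> (Inl 4) = x4"
    "\<psi> (Inr 0) = y0" "\<psi> (Inr 1) = y1" "\<psi> (Inr 2) = y2" "\<psi> (Inr 3) = y3" "\<psi> (Inr 4) = y4"
    by (simp_all add: \<psi>_def)
  have times: "{(Inl i, Inr j) | i j. i \<in> A \<and> j \<in> B} = Inl ` A \<times> Inr ` B" for A B :: "nat set"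
    by auto
  have diag: "{(Inl i, Inr (i + 1)) | i. i \<in> A} = (\<lambda>i. (Inl i, Inr (i + 1))) ` A" for A :: "nat set"
    by auto
  have two: "D10_two_way = {Inl 1, Inl 2, Inl 3} \<times> {Inr 0, Inr 1} \<union>
      {(Inl 4, Inr 1), (Inl 0, Inr 0)} \<union> {(Inl 1, Inr 2), (Inl 2, Inr 3), (Inl 3, Inr 4)}"
    unfolding D10_two_way_def times diag by (simp add: numeral_eq_Suc)
  have one: "D10_one_way = {Inl 1, Inl 2, Inl 3} \<times> {Inr 2, Inr 3, Inr 4}"
    unfolding D10_one_way_def times by simp
  have m: "map \<psi> [Inl 0, Inl 1, Inl 2, Inl 3, Inl 4, Inr 0, Inr 1, Inr 2, Inr 3, Inr 4] =
      [x0, x1, x2, x3, x4, y0, y1, y2, y3, y4]"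
    by (simp only: \<psi> list.map)
  have inj: "inj_on \<psi> (set [Inl 0, Inl 1, Inl 2, Inl 3, Inl 4, Inr 0, Inr 1, Inr 2, Inr 3, Inr 4])"
    using d by (metis m distinct_map)
  have im: "\<psi> ` set [Inl 0, Inl 1, Inl 2, Inl 3, Inl 4, Inr 0, Inr 1, Inr 2, Inr 3, Inr 4] =
      {x0, x1, x2, x3, x4, y0, y1, y2, y3, y4}"
    unfolding set_map[symmetric] m by (simp only: list.set)
  have pv: "Inl ` {0..4} \<union> Inr ` {0..4} = set [Inl 0, Inl 1, Inl 2, Inl 3, Inl 4, Inr 0, Inr 1, Inr 2, Inr 3, Inr 4 :: nat + nat]"
    unfolding n5 by auto
  have img: "map_prod \<psi> \<psi> ` (A \<times> B) = (\<psi> ` A) \<times> (\<psi> ` B)" for A B by auto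
  have conv: "R\<inverse> = prod.swap ` R" for R :: "(nat + nat) rel" by auto
  have D: "map_prod \<psi> \<psi> ` D10_two_way = {x1, x2, x3} \<times> {y0, y1} \<union> {(x4, y1), (x0, y0)} \<union>
      {(x1, y2), (x2, y3), (x3, y4)}"
    "map_prod \<psi> \<psi> ` (D10_two_way\<inverse>) = {y0, y1} \<times> {x1, x2, x3} \<union> {(y1, x4), (y0, x0)} \<union>
      {(y2, x1), (y3, x2), (y4, x3)}"
    "map_prod \<psi> \<psi> ` D10_one_way = {x1, x2, x3} \<times> {y2, y3, y4}"
    unfolding two one conv image_Un product_swap img image_insert image_empty map_prod_simp swap_simp \<psi>
    by (rule refl)+
  have E': "arcs_ends G = ({x1, x2, x3} \<times> {y0, y1} \<union> {x1, x2, x3} \<times> {y2, y3, y4}) \<union> {y0, y1} \<times> {x1, x2, x3} \<union>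
      {(y2, x1), (y3, x2), (y4, x3), (x0, y0), (y0, x0), (x4, y1), (y1, x4)}"
    unfolding E Sigma_Un_distrib2[symmetric] by (simp only: insert_is_Un[symmetric] Un_insert_left Un_empty_left)
  \<comment> \<open>The arcs from \<open>xi\<close> to \<open>y(i+1)\<close> come from both the
    two-way and the one-way relation. \<open>B\<close> stands for this overlap, which
    \<open>Q\<close> absorbs.\<close>
  have assemble: "(P \<union> Q) \<union> R \<union> S = (P \<union> A \<union> B) \<union> (R \<union> A' \<union> B') \<union> Q"
    if "B \<subseteq> Q" "S = A \<union> A' \<union> B'" for P Q R S A B A' B' :: "('a \<times> 'a) set"
    using that by blast
  show ?thesis
    unfolding D10_def
  proof (rule digraph_iso_with_proj[where \<psi> = \<psi>])
    show "bij_betw \<psi> (pverts \<lparr>pverts = Inl ` {0..4} \<union> Inr ` {0..4},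
        parcs = D10_two_way \<union> D10_two_way\<inverse> \<union> D10_one_way\<rparr>) (verts G)"
      unfolding bij_betw_def pair_pre_digraph.simps pv V using inj im by blast
    show "arcs_ends G = map_prod \<psi> \<psi> ` parcs \<lparr>pverts = Inl ` {0..4} \<union> Inr ` {0..4},
        parcs = D10_two_way \<union> D10_two_way\<inverse> \<union> D10_one_way\<rparr>"
      unfolding E' pair_pre_digraph.simps image_Un D
    proof (rule assemble)
      show "{(x1, y2), (x2, y3), (x3, y4)} \<subseteq> {x1, x2, x3} \<times> {y2, y3, y4}" by simp
      show "{(y2, x1), (y3, x2), (y4, x3), (x0, y0), (y0, x0), (x4, y1), (y1, x4)} =
          {(x4, y1), (x0, y0)} \<union> {(y1, x4), (y0, x0)} \<union> {(y2, x1), (y3, x2), (y4, x3)}"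
        by (simp only: Un_insert_left Un_empty_left insert_commute)
    qed
    have "D10_two_way \<subseteq> Inl ` {0..4} \<times> Inr ` {0..4}" "D10_one_way \<subseteq> Inl ` {0..4} \<times> Inr ` {0..4}"
      by (auto simp: D10_two_way_def D10_one_way_def)
    then show "parcs \<lparr>pverts = Inl ` {0..4} \<union> Inr ` {0..4}, parcs = D10_two_way \<union> D10_two_way\<inverse> \<union> D10_one_way\<rparr>
      \<subseteq> pverts \<lparr>pverts = Inl ` {0..4} \<union> Inr ` {0..4}, parcs = D10_two_way \<union> D10_two_way\<inverse> \<union> D10_one_way\<rparr> \<times>
        pverts \<lparr>pverts = Inl ` {0..4} \<union> Inr ` {0..4}, parcs = D10_two_way \<union> D10_two_way\<inverse> \<union> D10_one_way\<rparr>"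
      unfolding pair_pre_digraph.simps by blast
  qed
qed

section \<open>From the degree condition to low and high vertices\<close>

locale dominated_digraph = digraph G
  for G :: "('a, 'b) pre_digraph" (structure) +
  fixes X Y :: "'a set" and a :: nat
  assumes a: "5 \<le> a"
    and sc: "strongly_connected G"
    and XY: "X \<union> Y = verts G" "X \<inter> Y = {}"
    and card_XY: "card X = a" "card Y = a"
    and bip: "u \<rightarrow> v \<Longrightarrow> u \<in> X \<and> v \<in> Y \<or> u \<in> Y \<and> v \<in> X"
    and dom: "dominating_pair G u v \<Longrightarrow> 2 * a - 2 \<le> max (degree G u) (degree G v)"
begin

lemma swap: "dominated_digraph G Y X a"
proof unfold_locales
  show "Y \<union> X = verts G" "Y \<inter> X = {}" using XY by auto
  show "u \<in> Y \<and> v \<in> X \<or> u \<in> X \<and> v \<in> Y" if "u \<rightarrow> v" for u v using bip[OF that] by blast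
qed (fact a sc card_XY dom)+

definition low :: "'a set \<Rightarrow> 'a set" where
  "low S = {v \<in> S. degree G v < 2 * a - 2}"

lemma fin: "finite X" "finite Y"
  using XY finite_verts by (metis finite_Un)+

lemma degree_misses:
  assumes "x \<in> X"
  shows "degree G x + (card {y \<in> Y. \<not> x \<rightarrow> y} + card {y \<in> Y. \<not> y \<rightarrow> x}) = 2 * a"
proof -
  have split: "card {y. P y} + card {y \<in> Y. \<not> P y} = a" if "\<And>y. P y \<Longrightarrow> y \<in> Y" for P
  proof -
    have "card {y. P y} + card {y \<in> Y. \<not> P y} = card ({y. P y} \<union> {y \<in> Y. \<not> P y})"
      using fin(2) that by (intro card_Un_disjoint[symmetric]) (auto intro: finite_subset)
    also have "{y. P y} \<union> {y \<in> Y. \<not> P y} = Y" using that by auto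
    finally show ?thesis using card_XY by simp
  qed
  have "y \<in> Y" if "x \<rightarrow> y \<or> y \<rightarrow> x" for y using bip that assms XY by blast
  then show ?thesis
    using split[of "\<lambda>y. x \<rightarrow> y"] split[of "\<lambda>y. y \<rightarrow> x"] by (simp add: degree_def degree_conv)
qed

lemma high_misses:
  assumes "x \<in> X - low X"
  shows "card {y \<in> Y. \<not> x \<rightarrow> y} + card {y \<in> Y. \<not> y \<rightarrow> x} \<le> 2"
  using degree_misses[of x] assms by (auto simp: low_def)

lemma low_out_disjoint:
  assumes "u \<in> low X" "v \<in> low X" "u \<rightarrow> w" "v \<rightarrow> w"
  shows "u = v"
proof (rule ccontr)
  assume "u \<noteq> v"
  then have "dominating_pair G u v"
    using assms(3,4) adj_in_verts by (auto simp: dominating_pair_def)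
  then show False using dom[of u v] assms(1,2) by (auto simp: low_def)
qed

text \<open>A low vertex misses at least three arcs, and a single \<open>y\<close> accounts for at
  most two of them.\<close>

lemma low_two_missed:
  assumes "x \<in> low X" "y \<in> Y"
  shows "\<exists>y' \<in> Y - {y}. \<not> x \<rightarrow> y' \<or> \<not> y' \<rightarrow> x"
proof (rule ccontr)
  assume "\<not> ?thesis"
  then have "{y \<in> Y. \<not> x \<rightarrow> y} \<subseteq> {y}" "{y \<in> Y. \<not> y \<rightarrow> x} \<subseteq> {y}" by auto
  then have "card {y \<in> Y. \<not> x \<rightarrow> y} \<le> card {y}" "card {y \<in> Y. \<not> y \<rightarrow> x} \<le> card {y}"
    by (intro card_mono; simp)+
  then show False using degree_misses[of x] assms(1) by (auto simp: low_def)
qed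

lemma card_low:
  assumes "y \<in> Y - low Y"
  shows "card (low X) \<le> 3"
proof -
  have f: "finite (low X)" using fin by (simp add: low_def)
  have "card (low X \<inter> {x. x \<rightarrow> y}) \<le> Suc 0"
    using low_out_disjoint f by (auto simp: card_le_Suc0_iff_eq)
  moreover have "card (low X - {x. x \<rightarrow> y}) \<le> card {x \<in> X. \<not> x \<rightarrow> y}"
    using fin by (intro card_mono) (auto simp: low_def)
  moreover have "card {x \<in> X. \<not> x \<rightarrow> y} \<le> 2"
    using dominated_digraph.high_misses[OF swap, of y] assms by simp
  ultimately show ?thesis using card_Int_Diff[OF f, of "{x. x \<rightarrow> y}"] by simp
qed

text \<open>In-degrees in \<open>Y\<close> are at most 1, so degrees there are at most
  \<open>a + 1\<close>, which is below \<open>2 * a - 2\<close> since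
  \<open>a \<ge> 5\<close>.\<close>

lemma low_all_X:
  assumes "X \<subseteq> low X"
  shows "Y \<subseteq> low Y"
proof
  fix y assume y: "y \<in> Y"
  have "card {x. x \<rightarrow> y} \<le> Suc 0"
  proof -
    have "{x. x \<rightarrow> y} \<subseteq> X" using bip y XY by auto
    moreover from this have "finite {x. x \<rightarrow> y}" using fin finite_subset by auto
    ultimately show ?thesis
      using low_out_disjoint[of _ _ y] assms by (simp add: card_le_Suc0_iff_eq) blast
  qed
  moreover have "card {x. y \<rightarrow> x} \<le> card X"
    using bip y XY fin by (intro card_mono) auto
  ultimately have "degree G y \<le> Suc a"
    using card_XY by (simp add: degree_def degree_conv)
  then show "y \<in> low Y" using y a by (simp add: low_def)
qed

lemma directed_cycle_if_low:
  assumes "X \<subseteq> low X"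
  shows "digraph_iso G (directed_cycle (2 * a))"
proof (rule directed_cycle_if_in_unique[OF sc])
  have "card (X \<union> Y) = 2 * a" using card_XY card_Un_disjoint[OF fin XY(2)] by simp
  then show "card (verts G) = 2 * a" using XY by simp
  show "2 \<le> 2 * a" using a by simp
  fix u v w assume uv: "u \<rightarrow> w" "v \<rightarrow> w"
  have Y: "Y \<subseteq> low Y" using low_all_X[OF assms] .
  show "u = v"
    using bip[OF uv(1)] bip[OF uv(2)] low_out_disjoint[of u v w] assms uv XY Y
      dominated_digraph.low_out_disjoint[OF swap, of u v w] by blast
qed

lemma dominating_bipartite:
  assumes "\<not> X \<subseteq> low X" "\<not> Y \<subseteq> low Y"
  shows "dominating_bipartite (\<lambda>u v. (u, v) \<in> arcs_ends G) X Y (low X) (low Y) a"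
proof unfold_locales
  obtain x y where "x \<in> X - low X" "y \<in> Y - low Y" using assms by blast
  then show "card (low X) \<le> 3" "card (low Y) \<le> 3"
    using card_low dominated_digraph.card_low[OF swap] by auto
  show "S = X \<union> Y" if S: "S \<subseteq> X \<union> Y" "S \<noteq> {}" "\<And>u v. u \<in> S \<Longrightarrow> u \<rightarrow> v \<Longrightarrow> v \<in> S" for S
  proof -
    obtain u where "u \<in> S" using S by blast
    then have "v \<in> S" if "v \<in> verts G" for v
      using reachable_closed[of u v S] S that XY sc by (auto simp: strongly_connected_def)
    then show ?thesis using S XY by blast
  qed
  show "u = v" if "u \<in> low Y" "v \<in> low Y" "u \<rightarrow> w" "v \<rightarrow> w" for u v w
    using dominated_digraph.low_out_disjoint[OF swap] that by blast
  show "card {x \<in> X. \<not> y \<rightarrow> x} + card {x \<in> X. \<not> x \<rightarrow> y} \<le> 2" if "y \<in> Y - low Y" for y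
    using dominated_digraph.high_misses[OF swap] that by blast
  show "\<exists>x' \<in> X - {x}. \<not> y \<rightarrow> x' \<or> \<not> x' \<rightarrow> y" if "y \<in> low Y" "x \<in> X" for x y
    using dominated_digraph.low_two_missed[OF swap] that by blast
qed (fact fin XY(2) bip a card_XY low_out_disjoint high_misses low_two_missed | simp add: low_def)+

lemma even_pancyclic_or_D10:
  assumes "\<not> digraph_iso G (directed_cycle (2 * a))"
  shows "(\<forall>k \<in> {1..a - 1}. has_cycle_of_length G (2 * k)) \<or> digraph_iso G D10"
proof -
  have "\<not> X \<subseteq> low X" "\<not> Y \<subseteq> low Y"
    using directed_cycle_if_low dominated_digraph.directed_cycle_if_low[OF swap] assms
    by blast+
  then interpret B: dominating_bipartite "\<lambda>u v. (u, v) \<in> arcs_ends G" X Y "low X" "low Y" a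
    by (rule dominating_bipartite)
  show ?thesis
    using B.even_pancyclic_or_exception
  proof
    assume "B.even_pancyclic"
    then show ?thesis unfolding B.even_pancyclic_def by (metis has_cycle_of_length_cyc)
  next
    assume "B.ten_vertex_exception"
    then obtain x0 x1 x2 x3 x4 y0 y1 y2 y3 y4 where
      *: "distinct [x0, x1, x2, x3, x4, y0, y1, y2, y3, y4]"
        "X \<union> Y = {x0, x1, x2, x3, x4, y0, y1, y2, y3, y4}"
        "\<And>u v. u \<rightarrow> v \<longleftrightarrow> (u, v) \<in> {x1, x2, x3} \<times> {y0, y1, y2, y3, y4} \<union> {y0, y1} \<times> {x1, x2, x3} \<union>
          {(y2, x1), (y3, x2), (y4, x3), (x0, y0), (y0, x0), (x4, y1), (y1, x4)}"
      unfolding B.ten_vertex_exception_def by blast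
    have "arcs_ends G = {x1, x2, x3} \<times> {y0, y1, y2, y3, y4} \<union> {y0, y1} \<times> {x1, x2, x3} \<union>
          {(y2, x1), (y3, x2), (y4, x3), (x0, y0), (y0, x0), (x4, y1), (y1, x4)}"
      by (rule set_eqI) (simp only: *(3) split_paired_all)
    then show ?thesis using digraph_iso_D10[OF *(1)] *(2) XY(1) by simp
  qed
qed

end

theorem theorem1p8:
  fixes D :: "('a, 'b) pre_digraph" and a :: nat
  assumes "a \<ge> 5"
    and "digraph D"
    and "strongly_connected D"
    and "balanced_bipartite D"
    and "card (verts D) = 2 * a"
    and "\<not> digraph_iso D (directed_cycle (2 * a))"
    and "\<forall>x y. dominating_pair D x y \<longrightarrow> max (degree D x) (degree D y) \<ge> 2 * a - 2"
  shows "(\<forall>k \<in> {1..a - 1}. has_cycle_of_length D (2 * k)) \<or> digraph_iso D D10"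
proof -
  interpret digraph D by fact
  obtain X Y where XY: "X \<union> Y = verts D" "X \<inter> Y = {}" "card X = card Y"
    and bip: "\<And>e. e \<in> arcs D \<Longrightarrow> (tail D e \<in> X \<and> head D e \<in> Y) \<or> (tail D e \<in> Y \<and> head D e \<in> X)"
    using assms(4) unfolding balanced_bipartite_def by blast
  have "finite X" "finite Y" using XY(1) finite_verts by (metis finite_Un)+
  then have "card X + card Y = 2 * a" using card_Un_disjoint[of X Y] XY assms(5) by simp
  then have "card X = a" "card Y = a" using XY(3) by auto
  moreover have "u \<in> X \<and> v \<in> Y \<or> u \<in> Y \<and> v \<in> X" if uv: "u \<rightarrow>\<^bsub>D\<^esub> v" for u v
  proof -
    obtain e where "e \<in> arcs D" "tail D e = u" "head D e = v" using uv by (auto simp: arcs_ends_def arc_to_ends_def)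
    then show ?thesis using bip[of e] by auto
  qed
  ultimately interpret dominated_digraph D X Y a
    using assms(1,3,7) XY by unfold_locales auto
  show ?thesis using even_pancyclic_or_D10 assms(6) by blast
qed

end
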